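(* Let $V$ be a valuation ring whose maximal ideal $\mathfrak m$ is not finitely generated (equivalently, not principal). Then (1) $R^1\Gamma_{\mathfrak m}(\mathfrak m) \neq 0$. (2) There exists a $V$-module $M$ for which $R^2\Gamma_{\mathfrak m}(M) \neq 0$.
   Context: Rings are commutative with identity. $\mathbb N$ denotes the positive integers. For a ring $A$ and an ideal $I \subset A$, the $I$-torsion functor $\Gamma_I$ on $A$-modules is $\Gamma_I(M) = \{m \in M : \exists\, n \in \mathbb N \text{ such that } I^n m = 0\}$. It is left exact, and its right derived functors are denoted $R^i\Gamma_I$, $i \ge 0$ (the $I$-torsion cohomology functors). *)

theory Defs
  imports "HOL-Algebra.Divisibility" "HOL-Algebra.Ideal_Product" "HOL-Algebra.Module"
begin

text \<open>
  A valuation ring is an integral domain \<open>R\<close> such that every nonzero \<open>x\<close> in its field of fractions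
  satisfies \<open>x \<in> R\<close> or \<open>x\<inverse> \<in> R\<close>. Writing \<open>x = b / a\<close>, this is the condition below.
\<close>

locale valuation_ring = domain R for R (structure) +
  assumes divides_total: "\<lbrakk> a \<in> carrier R; b \<in> carrier R \<rbrakk> \<Longrightarrow> a divides b \<or> b divides a"

definition fin_gen_ideal :: "('a, 'r) ring_scheme \<Rightarrow> 'a set \<Rightarrow> bool" where
  "fin_gen_ideal R I \<longleftrightarrow> (\<exists>S. finite S \<and> S \<subseteq> carrier R \<and> I = genideal R S)"


section \<open>Modules\<close>

text \<open>
  The record type of modules extends that of rings, so that a module also has (unused)
  components \<open>mult\<close> and \<open>one\<close>.
\<close>

definition ideal_module :: "('a, 'r) ring_scheme \<Rightarrow> 'a set \<Rightarrow> ('a, 'a) module" where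
  "ideal_module R I = \<lparr> carrier = I, mult = mult R, one = one R, zero = zero R, add = add R,
     smult = mult R \<rparr>"

definition quotient_module ::
    "('a, 'r) ring_scheme \<Rightarrow> ('a, 'b) module \<Rightarrow> 'b set \<Rightarrow> ('a, 'b set) module" where
  "quotient_module R M N = \<lparr> carrier = a_rcosets\<^bsub>M\<^esub> N, mult = undefined, one = undefined,
     zero = N, add = set_add M,
     smult = (\<lambda>r X. \<Union>x\<in>X. N +>\<^bsub>M\<^esub> (r \<odot>\<^bsub>M\<^esub> x)) \<rparr>"

definition mod_hom ::
    "('a, 'r) ring_scheme \<Rightarrow> ('a, 'b) module \<Rightarrow> ('a, 'c) module \<Rightarrow> ('b \<Rightarrow> 'c) set" where
  "mod_hom R M N = {f. f \<in> carrier M \<rightarrow> carrier N \<and>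
     (\<forall>x\<in>carrier M. \<forall>y\<in>carrier M. f (x \<oplus>\<^bsub>M\<^esub> y) = f x \<oplus>\<^bsub>N\<^esub> f y) \<and>
     (\<forall>r\<in>carrier R. \<forall>x\<in>carrier M. f (r \<odot>\<^bsub>M\<^esub> x) = r \<odot>\<^bsub>N\<^esub> f x)}"

text \<open>
  Injective objects of the category of \<open>R\<close>-modules with carrier in the type \<open>'b\<close>. Whenever \<open>'a\<close>
  embeds in \<open>'b\<close>, as is the case in the definition of the derived functors below, the inclusions of
  ideals into \<open>R\<close> occur (up to isomorphism) among the monomorphisms tested here, so by Baer's
  criterion this is injectivity with respect to all \<open>R\<close>-modules.
\<close>

definition injective_module :: "('a, 'r) ring_scheme \<Rightarrow> ('a, 'b) module \<Rightarrow> bool" where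
  "injective_module R E \<longleftrightarrow> module R E \<and>
     (\<forall>(A :: ('a, 'b) module) (B :: ('a, 'b) module) j f.
        module R A \<longrightarrow> module R B \<longrightarrow> j \<in> mod_hom R A B \<longrightarrow> inj_on j (carrier A) \<longrightarrow>
        f \<in> mod_hom R A E \<longrightarrow>
        (\<exists>g\<in>mod_hom R B E. \<forall>x\<in>carrier A. g (j x) = f x))"

definition injective_resolution ::
    "('a, 'r) ring_scheme \<Rightarrow> ('a, 'm) module \<Rightarrow>
     (nat \<Rightarrow> ('a, 'b) module) \<Rightarrow> ('m \<Rightarrow> 'b) \<Rightarrow> (nat \<Rightarrow> 'b \<Rightarrow> 'b) \<Rightarrow> bool" where
  "injective_resolution R M E \<epsilon> d \<longleftrightarrow>
     (\<forall>n. injective_module R (E n)) \<and>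
     \<epsilon> \<in> mod_hom R M (E 0) \<and> inj_on \<epsilon> (carrier M) \<and>
     (\<forall>n. d n \<in> mod_hom R (E n) (E (Suc n))) \<and>
     \<epsilon> ` carrier M = {x \<in> carrier (E 0). d 0 x = \<zero>\<^bsub>E 1\<^esub>} \<and>
     (\<forall>n. d n ` carrier (E n) = {x \<in> carrier (E (Suc n)). d (Suc n) x = \<zero>\<^bsub>E (Suc (Suc n))\<^esub>})"


section \<open>Torsion and its right derived functors\<close>

text \<open>
  \<open>\<Gamma>\<^sub>I\<close> on objects; on morphisms it is restriction. Powers of \<open>I\<close> are taken in the monoid of ideals
  under the ideal product.
\<close>

definition torsion_module ::
    "('a, 'r) ring_scheme \<Rightarrow> 'a set \<Rightarrow> ('a, 'b) module \<Rightarrow> ('a, 'b) module" where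
  "torsion_module R I M = M \<lparr> carrier :=
     {x \<in> carrier M. \<exists>n::nat. n \<ge> 1 \<and> (\<forall>a \<in> I [^]\<^bsub>ideals_set R\<^esub> n. a \<odot>\<^bsub>M\<^esub> x = \<zero>\<^bsub>M\<^esub>)} \<rparr>"

text \<open>Cohomology in degree \<open>i\<close> of a complex \<open>C 0 \<rightarrow> C 1 \<rightarrow> C 2 \<rightarrow> \<dots>\<close> with differentials \<open>d\<close>.\<close>

definition cocycles :: "(nat \<Rightarrow> ('a, 'b) module) \<Rightarrow> (nat \<Rightarrow> 'b \<Rightarrow> 'b) \<Rightarrow> nat \<Rightarrow> 'b set" where
  "cocycles C d i = {x \<in> carrier (C i). d i x = \<zero>\<^bsub>C (Suc i)\<^esub>}"

definition coboundaries :: "(nat \<Rightarrow> ('a, 'b) module) \<Rightarrow> (nat \<Rightarrow> 'b \<Rightarrow> 'b) \<Rightarrow> nat \<Rightarrow> 'b set" where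
  "coboundaries C d i = (case i of 0 \<Rightarrow> {\<zero>\<^bsub>C 0\<^esub>} | Suc j \<Rightarrow> d j ` carrier (C j))"

definition cohomology ::
    "('a, 'r) ring_scheme \<Rightarrow> (nat \<Rightarrow> ('a, 'b) module) \<Rightarrow> (nat \<Rightarrow> 'b \<Rightarrow> 'b) \<Rightarrow> nat \<Rightarrow> ('a, 'b set) module"
  where
  "cohomology R C d i =
     quotient_module R (C i \<lparr> carrier := cocycles C d i \<rparr>) (coboundaries C d i)"

text \<open>
  A type in which the injective resolutions of modules with carrier in \<open>'m\<close> over a ring with carrier
  in \<open>'a\<close> are formed. Its cardinality is \<open>\<kappa> = 2\<^sup>\<lambda>\<close>, where \<open>\<lambda> = max (\<bar>'a\<bar>, \<bar>'m\<bar>, \<aleph>\<^sub>0)\<close>; hence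
  there are at most \<open>\<kappa>\<close> functions from \<open>'a\<close> to a set with \<open>\<kappa>\<close> elements. A module \<open>N\<close> with at most \<open>\<kappa>\<close>
  elements embeds, as an abelian group, in a divisible group \<open>D\<close> with at most \<open>\<kappa>\<close> elements, and so,
  as a module, in the injective module of additive maps from \<open>R\<close> to \<open>D\<close>, which again has at most
  \<open>\<kappa>\<close> elements. Iterating, every module with carrier in \<open>'m\<close> has an injective resolution by modules
  with carriers in this type.
\<close>

type_synonym ('a, 'm) resolution_type = "('a + 'm) list set"

text \<open>
  \<open>R\<^sup>i\<Gamma>\<^sub>I(M)\<close>, computed from a chosen injective resolution of \<open>M\<close>; up to isomorphism the result does
  not depend on the choice.
\<close>

definition derived_torsion ::
    "('a, 'r) ring_scheme \<Rightarrow> 'a set \<Rightarrow> nat \<Rightarrow> ('a, 'm) module \<Rightarrow>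
     ('a, ('a, 'm) resolution_type set) module" where
  "derived_torsion R I i M =
     (let (E, \<epsilon>, d) =
        (SOME (E, \<epsilon>, d). injective_resolution R M
           (E :: nat \<Rightarrow> ('a, ('a, 'm) resolution_type) module) \<epsilon> d)
      in cohomology R (\<lambda>n. torsion_module R I (E n)) d i)"

definition nonzero_module :: "('a, 'b) module \<Rightarrow> bool" where
  "nonzero_module M \<longleftrightarrow> carrier M \<noteq> {\<zero>\<^bsub>M\<^esub>}"

end

theory Submission
  imports "HOL-Algebra.Free_Abelian_Groups" Defs
begin

text \<open>
  A maximal ideal \<open>\<mm>\<close> of a valuation ring that is not finitely generated is idempotent, so
  \<open>\<Gamma>\<^sub>\<mm>(M)\<close> is the submodule annihilated by \<open>\<mm>\<close>, that is \<open>Hom(V/\<mm>, M)\<close>, and \<open>R\<^sup>i\<Gamma>\<^sub>\<mm> = Ext\<^sup>i(V/\<mm>, -)\<close>.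
  The extension \<open>0 \<rightarrow> \<mm> \<rightarrow> V \<rightarrow> V/\<mm> \<rightarrow> 0\<close> does not split because \<open>V\<close> is a domain, so
  \<open>Ext\<^sup>1(V/\<mm>, \<mm>) \<noteq> 0\<close>. By dimension shifting \<open>Ext\<^sup>2(V/\<mm>, K)\<close> contains \<open>Ext\<^sup>1(\<mm>, K)\<close>, which is nonzero for
  the kernel \<open>K\<close> of the surjection from the free module on \<open>\<mm>\<close> onto \<open>\<mm>\<close>: a section of it would show
  that \<open>\<mm>\<close> is generated by the finite support of the image of any nonzero element. The classes are
  constructed directly in an arbitrary injective resolution. Resolutions with carriers in the
  prescribed type exist because a module embeds into the additive maps from \<open>V\<close> to a divisible group
  containing it.
\<close>

section \<open>Extending homomorphisms into divisible groups\<close>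

text \<open>The resolution in \<open>derived_torsion\<close> is picked by \<open>SOME\<close>:
  nothing is known of it except that it is an injective resolution, provided one exists. Exhibiting
  a class that survives in every resolution replaces the comparison of resolutions, but existence
  within one fixed carrier type has to be proved. This is where cardinalities enter: finite subsets
  of the product of an infinite set with a countable one are no more numerous than the infinite set,
  so a divisible hull fits into the type, and the outer \<open>set\<close> in
  \<open>resolution_type\<close> absorbs the functions from the ring. Fixed types also shape the use
  of injectivity: the ring, an ideal or a free module has to be moved into the resolution type
  before a map from it can be extended. In degree two, vanishing of the class is turned into a
  retraction of the free module onto \<open>K\<close>; the complementary projection yields a section
  over \<open>\<mm>\<close>, which enters through the cross relations
  \<open>b s(a) = a s(b)\<close>.\<close>

lemma DirProd_int_pow:
  assumes "group B" "group D" "b \<in> carrier B" "d \<in> carrier D"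
  shows "(b, d) [^]\<^bsub>B \<times>\<times> D\<^esub> (n::int) = (b [^]\<^bsub>B\<^esub> n, d [^]\<^bsub>D\<^esub> n)"
proof -
  interpret P: group "B \<times>\<times> D" using assms by (simp add: DirProd_group)
  have "fst \<in> hom (B \<times>\<times> D) B" "snd \<in> hom (B \<times>\<times> D) D"
    by (auto simp: hom_def DirProd_def)
  then have "fst ((b, d) [^]\<^bsub>B \<times>\<times> D\<^esub> n) = b [^]\<^bsub>B\<^esub> n" "snd ((b, d) [^]\<^bsub>B \<times>\<times> D\<^esub> n) = d [^]\<^bsub>D\<^esub> n"
    using hom_int_pow[of fst "B \<times>\<times> D" B "(b,d)"] hom_int_pow[of snd "B \<times>\<times> D" D "(b,d)"] assms P.is_group
    by (auto simp: carrier_DirProd)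
  then show ?thesis by (metis prod.collapse)
qed

text \<open>\<open>S\<close> is a subgroup of the integers and \<open>k\<close> its generator: the
  least positive element, by division with remainder, or 0 for the zero subgroup. It is meant for
  the exponents at which powers of an element lie in a given domain.\<close>

lemma subgroup_int_multiples:
  fixes S :: "int set"
  assumes "0 \<in> S" "\<And>m n. m \<in> S \<Longrightarrow> n \<in> S \<Longrightarrow> m - n \<in> S"
  shows "\<exists>k\<in>S. k \<ge> 0 \<and> (\<forall>n\<in>S. k dvd n)"
proof (cases "S = {0}")
  case True
  then show ?thesis by auto
next
  case False
  have add: "m + n \<in> S" if "m \<in> S" "n \<in> S" for m n
    using assms(2)[OF that(1) assms(2)[OF assms(1) that(2)]] by simp
  have neg: "-n \<in> S" if "n \<in> S" for n using assms(2)[OF assms(1) that] by simp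
  obtain n where n: "n \<in> S" "n \<noteq> 0" using False assms(1) by auto
  then have ex: "\<exists>i::nat. i > 0 \<and> int i \<in> S"
    using neg[of n] by (intro exI[of _ "nat \<bar>n\<bar>"]) (auto simp: abs_if)
  define i where "i = (LEAST i::nat. i > 0 \<and> int i \<in> S)"
  have i: "i > 0" "int i \<in> S" using LeastI_ex[OF ex] by (auto simp: i_def)
  have mult: "int k * int i \<in> S" for k
    by (induct k) (use assms(1) i add in \<open>auto simp: algebra_simps\<close>)
  have mult': "q * int i \<in> S" for q
    using mult[of "nat \<bar>q\<bar>"] neg[of "\<bar>q\<bar> * int i"] by (cases "q \<ge> 0") auto
  have "int i dvd m" if "m \<in> S" for m
  proof -
    have "m mod int i \<in> S"
      using assms(2)[OF that mult'[of "m div int i"]] by (simp add: minus_div_mult_eq_mod)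
    then have "\<not> nat (m mod int i) > 0 "
      using not_less_Least[of "nat (m mod int i)" "\<lambda>i. i > 0 \<and> int i \<in> S"] i(1)
      by (auto simp: i_def[symmetric] nat_less_iff)
    moreover have "0 \<le> m mod int i" using i(1) by simp
    ultimately show ?thesis using i(1) by (simp add: dvd_eq_mod_eq_0)
  qed
  then show ?thesis using i by (intro bexI[of _ "int i"]) auto
qed

text \<open>
  A maximal partial homomorphism, represented by its graph, is total: it could be extended to
  \<open>b\<close> by choosing the value at \<open>b\<close> as a \<open>k\<close>-th root of the value at \<open>b\<^sup>k\<close>, where \<open>b\<^sup>k\<close> generates
  the powers of \<open>b\<close> in the domain.
\<close>

lemma divisible_extension:
  assumes "comm_group A" "comm_group B" "comm_group D"
    and j: "j \<in> hom A B" "inj_on j (carrier A)"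
    and f: "f \<in> hom A D"
    and divisible: "\<And>n y. (n::int) > 0 \<Longrightarrow> y \<in> carrier D \<Longrightarrow> \<exists>d\<in>carrier D. d [^]\<^bsub>D\<^esub> n = y"
  shows "\<exists>g\<in>hom B D. \<forall>x\<in>carrier A. g (j x) = f x"
proof -
  interpret A: comm_group A by fact
  interpret B: comm_group B by fact
  interpret D: comm_group D by fact
  let ?P = "B \<times>\<times> D"
  interpret P: comm_group ?P by (intro group.group_comm_groupI DirProd_group) (auto simp: DirProd_def A.m_comm B.m_comm D.m_comm)
  interpret j: group_hom A B j by unfold_locales fact
  interpret f: group_hom A D f by unfold_locales fact
  define graph where "graph = (\<lambda>x. (j x, f x)) ` carrier A"
  \<comment> \<open>A subgroup of the product in which only the identity lies over the identity is
    single-valued, hence the graph of a homomorphism on a subgroup of \<open>B\<close>. Injectivity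
    of \<open>j\<close> puts \<open>graph\<close> into this family.\<close>
  define \<G> where "\<G> = {G. subgroup G ?P \<and> graph \<subseteq> G \<and> (\<forall>d. (\<one>\<^bsub>B\<^esub>, d) \<in> G \<longrightarrow> d = \<one>\<^bsub>D\<^esub>)}"
  have "(\<lambda>x. (j x, f x)) \<in> hom A ?P"
    by (auto simp: hom_def DirProd_def)
  then interpret gr: group_hom A ?P "\<lambda>x. (j x, f x)" by unfold_locales
  have "graph \<in> \<G>"
  proof -
    have "subgroup graph ?P"
      unfolding graph_def by (rule gr.img_is_subgroup)
    moreover have "d = \<one>\<^bsub>D\<^esub>" if "(\<one>\<^bsub>B\<^esub>, d) \<in> graph" for d
      using that j(2) by (auto simp: graph_def) (metis A.one_closed f.hom_one inj_onD j.hom_one)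
    ultimately show ?thesis by (auto simp: \<G>_def)
  qed
  have "\<Union>C \<in> \<G>" if "C \<noteq> {}" "subset.chain \<G> C" for C
  proof -
    have sub: "subgroup G ?P" if "G \<in> C" for G
      using that \<open>subset.chain \<G> C\<close> by (auto simp: \<G>_def subset.chain_def)
    have "subgroup (\<Union>C) ?P"
    proof (rule P.subgroupI)
      show "\<Union>C \<subseteq> carrier ?P" using sub subgroup.subset by blast
      show "\<Union>C \<noteq> {}" using \<open>C \<noteq> {}\<close> sub subgroup.one_closed by blast
      show "inv\<^bsub>?P\<^esub> a \<in> \<Union>C" if "a \<in> \<Union>C" for a
        using that subgroup.m_inv_closed[OF sub] by (meson UnionE UnionI)
      fix a b assume "a \<in> \<Union>C" "b \<in> \<Union>C"
      then obtain G where "G \<in> C" "a \<in> G" "b \<in> G"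
        using \<open>subset.chain \<G> C\<close> by (auto simp: subset_chain_def) (meson subsetD)
      then show "a \<otimes>\<^bsub>?P\<^esub> b \<in> \<Union>C" using subgroup.m_closed[OF sub] by (meson UnionI)
    qed
    moreover have "C \<subseteq> \<G>" using that by (simp add: subset.chain_def)
    then have "graph \<subseteq> \<Union>C" "\<forall>d. (\<one>\<^bsub>B\<^esub>, d) \<in> \<Union>C \<longrightarrow> d = \<one>\<^bsub>D\<^esub>"
      using \<open>C \<noteq> {}\<close> unfolding \<G>_def by blast+
    ultimately show ?thesis by (auto simp: \<G>_def)
  qed
  then obtain G where G: "G \<in> \<G>" and max: "\<And>X. X \<in> \<G> \<Longrightarrow> G \<subseteq> X \<Longrightarrow> X = G"
    using subset_Zorn_nonempty[of \<G>] \<open>graph \<in> \<G>\<close> by blast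
  interpret G: subgroup G ?P using G by (simp add: \<G>_def)
  have inv: "(x \<otimes>\<^bsub>B\<^esub> inv\<^bsub>B\<^esub> x', y \<otimes>\<^bsub>D\<^esub> inv\<^bsub>D\<^esub> y') \<in> G" if "(x, y) \<in> G" "(x', y') \<in> G" for x x' y y'
  proof -
    have "(x', y') \<in> carrier ?P" using G.subset that(2) by blast
    then have "inv\<^bsub>?P\<^esub> (x', y') = (inv\<^bsub>B\<^esub> x', inv\<^bsub>D\<^esub> y')"
      using inv_DirProd[OF B.is_group D.is_group] by simp
    then show ?thesis using G.m_closed[OF that(1) G.m_inv_closed[OF that(2)]] by simp
  qed
  have unique: "y = y'" if "(x, y) \<in> G" "(x, y') \<in> G" for x y y'
  proof -
    have c: "x \<in> carrier B" "y \<in> carrier D" "y' \<in> carrier D"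
      using G.subset that by (auto simp: DirProd_def)
    then have "y \<otimes>\<^bsub>D\<^esub> inv\<^bsub>D\<^esub> y' = \<one>\<^bsub>D\<^esub>"
      using inv[OF that] G by (simp add: \<G>_def)
    then show ?thesis using c by (metis D.inv_closed D.inv_equality D.inv_inv)
  qed
  have total: "\<exists>d. (b, d) \<in> G" if b: "b \<in> carrier B" for b
  proof -
    \<comment> \<open>The exponents of those powers of \<open>b\<close> on which \<open>G\<close> is
      already defined. A value at \<open>b\<close> has to be compatible with all of them, and
      compatibility at the generator \<open>k\<close> suffices.\<close>
    define S where "S = {n::int. \<exists>y. (b [^]\<^bsub>B\<^esub> n, y) \<in> G}"
    have "0 \<in> S" using G.one_closed by (auto simp: S_def)
    moreover have "m - n \<in> S" if "m \<in> S" "n \<in> S" for m n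
      using that inv b by (fastforce simp: S_def B.int_pow_diff)
    ultimately have "\<exists>k\<in>S. k \<ge> 0 \<and> (\<forall>n\<in>S. k dvd n)"
      by (rule subgroup_int_multiples)
    then obtain k where k: "k \<in> S" "k \<ge> 0" "\<And>n. n \<in> S \<Longrightarrow> k dvd n" by blast
    then obtain y where y: "(b [^]\<^bsub>B\<^esub> k, y) \<in> G" by (auto simp: S_def)
    then have yc: "y \<in> carrier D" using G.subset by (auto simp: DirProd_def)
    \<comment> \<open>If \<open>k = 0\<close>, then \<open>y\<close> lies over the identity, so it
      is the identity and every \<open>d\<close> satisfies the equation. Otherwise divisibility
      supplies a root.\<close>
    obtain d where d: "d \<in> carrier D" "d [^]\<^bsub>D\<^esub> k = y"
    proof (cases "k = 0")
      case True
      then have "y = \<one>\<^bsub>D\<^esub>" using y G by (simp add: \<G>_def)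
      then show ?thesis using that[of "\<one>\<^bsub>D\<^esub>"] True by simp
    next
      case False
      then show ?thesis using divisible[of k y] k(2) yc that by auto
    qed
    \<comment> \<open>On the powers of \<open>b\<close> in its domain \<open>G\<close> takes the
      corresponding powers of \<open>d\<close>, so adjoining \<open>(b, d)\<close> keeps the
      subgroup single-valued.\<close>
    have key: "z = d [^]\<^bsub>D\<^esub> n" if "(b [^]\<^bsub>B\<^esub> n, z) \<in> G" for n :: int and z
    proof -
      have "n \<in> S" using that by (auto simp: S_def)
      then obtain q where q: "n = k * q" using k(3) by (auto elim: dvdE)
      have "(b [^]\<^bsub>B\<^esub> k, y) [^]\<^bsub>?P\<^esub> q \<in> G" using y by (rule P.subgroup_int_pow_closed[OF G.subgroup_axioms])
      then have "(b [^]\<^bsub>B\<^esub> n, d [^]\<^bsub>D\<^esub> n) \<in> G"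
        using b yc d by (simp add: DirProd_int_pow B.int_pow_pow q D.int_pow_pow[symmetric])
      then show ?thesis using unique that by blast
    qed
    let ?H = "generate ?P {(b, d)}"
    have bd: "(b, d) \<in> carrier ?P" using b d by (simp add: DirProd_def)
    have H: "subgroup ?H ?P" using bd by (intro P.generate_is_subgroup) auto
    let ?G' = "G <#>\<^bsub>?P\<^esub> ?H"
    have "subgroup ?G' ?P" by (rule P.mult_subgroups[OF G.subgroup_axioms H])
    moreover have sub: "G \<subseteq> ?G'"
    proof
      fix p assume "p \<in> G"
      then have "p = p \<otimes>\<^bsub>?P\<^esub> \<one>\<^bsub>?P\<^esub>" using G.subset by (metis P.r_one subsetD)
      then show "p \<in> ?G'" using \<open>p \<in> G\<close> subgroup.one_closed[OF H] unfolding set_mult_def by blast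
    qed
    moreover have "y' = \<one>\<^bsub>D\<^esub>" if y': "(\<one>\<^bsub>B\<^esub>, y') \<in> ?G'" for y'
    proof -
      obtain p n where "p \<in> G" "(\<one>\<^bsub>B\<^esub>, y') = p \<otimes>\<^bsub>?P\<^esub> (b, d) [^]\<^bsub>?P\<^esub> (n::int)"
        using y' unfolding set_mult_def P.generate_pow[OF bd] by blast
      then obtain x z where xz: "(x, z) \<in> G" and "(\<one>\<^bsub>B\<^esub>, y') = (x, z) \<otimes>\<^bsub>?P\<^esub> (b, d) [^]\<^bsub>?P\<^esub> n"
        by (cases p) auto
      then have e: "\<one>\<^bsub>B\<^esub> = x \<otimes>\<^bsub>B\<^esub> b [^]\<^bsub>B\<^esub> n" "y' = z \<otimes>\<^bsub>D\<^esub> d [^]\<^bsub>D\<^esub> n"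
        using b d by (auto simp: DirProd_int_pow)
      have c: "x \<in> carrier B" "z \<in> carrier D" using xz G.subset by (auto simp: DirProd_def)
      then have "x = b [^]\<^bsub>B\<^esub> (-n)" using e(1) b
        by (metis B.int_pow_closed B.int_pow_neg B.inv_equality B.inv_inv)
      then have "z = d [^]\<^bsub>D\<^esub> (-n)" using key xz by blast
      then show ?thesis using e(2) d by (simp add: D.int_pow_neg)
    qed
    ultimately have "?G' \<in> \<G>" using G by (auto simp: \<G>_def)
    then have "?G' = G" using max sub by blast
    moreover have "(b, d) \<in> ?G'"
    proof -
      have "(b, d) = \<one>\<^bsub>?P\<^esub> \<otimes>\<^bsub>?P\<^esub> (b, d)" using bd by (metis P.l_one)
      moreover have "(b, d) \<in> ?H" by (auto intro: generate.incl)
      ultimately show ?thesis using G.one_closed unfolding set_mult_def by blast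
    qed
    ultimately show ?thesis by blast
  qed
  define g where "g b = (THE d. (b, d) \<in> G)" for b
  have g_eq: "g b = d" if "(b, d) \<in> G" for b d
    unfolding g_def using that unique by blast
  then have g: "(b, g b) \<in> G" if "b \<in> carrier B" for b using total[OF that] by auto
  have "g \<in> hom B D"
  proof (rule homI)
    show "g x \<in> carrier D" if "x \<in> carrier B" for x using g[OF that] G.subset by (auto simp: DirProd_def)
    show "g (x \<otimes>\<^bsub>B\<^esub> y) = g x \<otimes>\<^bsub>D\<^esub> g y" if "x \<in> carrier B" "y \<in> carrier B" for x y
      using g_eq G.m_closed[OF g[OF that(1)] g[OF that(2)]] by simp
  qed
  moreover have "g (j x) = f x" if "x \<in> carrier A" for x
    using that G g_eq by (auto simp: \<G>_def graph_def)
  ultimately show ?thesis by blast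
qed

section \<open>Modules\<close>

lemma (in abelian_group) minus_eq_zero_iff [simp]:
  assumes "x \<in> carrier G" "y \<in> carrier G"
  shows "x \<ominus> y = \<zero> \<longleftrightarrow> x = y"
  using assms by (metis a_minus_def add.inv_closed minus_equality r_neg minus_minus)

lemma mod_homD:
  assumes "f \<in> mod_hom R M N"
  shows "x \<in> carrier M \<Longrightarrow> f x \<in> carrier N"
    and "x \<in> carrier M \<Longrightarrow> y \<in> carrier M \<Longrightarrow> f (x \<oplus>\<^bsub>M\<^esub> y) = f x \<oplus>\<^bsub>N\<^esub> f y"
    and "r \<in> carrier R \<Longrightarrow> x \<in> carrier M \<Longrightarrow> f (r \<odot>\<^bsub>M\<^esub> x) = r \<odot>\<^bsub>N\<^esub> f x"
  using assms by (auto simp: mod_hom_def)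

lemma mod_homI:
  assumes "\<And>x. x \<in> carrier M \<Longrightarrow> f x \<in> carrier N"
    and "\<And>x y. x \<in> carrier M \<Longrightarrow> y \<in> carrier M \<Longrightarrow> f (x \<oplus>\<^bsub>M\<^esub> y) = f x \<oplus>\<^bsub>N\<^esub> f y"
    and "\<And>r x. r \<in> carrier R \<Longrightarrow> x \<in> carrier M \<Longrightarrow> f (r \<odot>\<^bsub>M\<^esub> x) = r \<odot>\<^bsub>N\<^esub> f x"
  shows "f \<in> mod_hom R M N"
  using assms by (auto simp: mod_hom_def)

lemma mod_hom_comp:
  assumes "f \<in> mod_hom R M N" "g \<in> mod_hom R N P"
  shows "(\<lambda>x. g (f x)) \<in> mod_hom R M P"
  by (intro mod_homI) (simp_all add: mod_homD[OF assms(1)] mod_homD[OF assms(2)])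

lemma mod_hom_group_hom:
  assumes "module R M" "module R N" "f \<in> mod_hom R M N"
  shows "group_hom (add_monoid M) (add_monoid N) f"
proof -
  interpret M: module R M by fact
  interpret N: module R N by fact
  show ?thesis
    by (intro group_hom.intro group_hom_axioms.intro M.a_group N.a_group homI)
      (simp_all add: mod_homD[OF assms(3)])
qed

lemma mod_hom_zero:
  assumes "module R M" "module R N" "f \<in> mod_hom R M N"
  shows "f \<zero>\<^bsub>M\<^esub> = \<zero>\<^bsub>N\<^esub>"
  using group_hom.hom_one[OF mod_hom_group_hom[OF assms]] by simp

lemma mod_hom_minus:
  assumes "module R M" "module R N" "f \<in> mod_hom R M N" "x \<in> carrier M"
  shows "f (\<ominus>\<^bsub>M\<^esub> x) = \<ominus>\<^bsub>N\<^esub> f x"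
  using group_hom.hom_inv[OF mod_hom_group_hom[OF assms(1-3)]] assms(4) by (simp add: a_inv_def)

lemma mod_hom_diff:
  assumes "module R M" "module R N" "f \<in> mod_hom R M N" "x \<in> carrier M" "y \<in> carrier M"
  shows "f (x \<ominus>\<^bsub>M\<^esub> y) = f x \<ominus>\<^bsub>N\<^esub> f y"
proof -
  interpret M: module R M by fact
  show ?thesis using assms by (simp add: a_minus_def mod_homD mod_hom_minus)
qed

lemma submodule_kernel:
  assumes "module R M" "module R N" "f \<in> mod_hom R M N"
  shows "submodule {x \<in> carrier M. f x = \<zero>\<^bsub>N\<^esub>} R M"
proof -
  interpret M: module R M by fact
  interpret N: module R N by fact
  show ?thesis
    by (rule M.submoduleI)
      (auto simp: mod_homD[OF assms(3)] mod_hom_zero[OF assms] mod_hom_minus[OF assms])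
qed

lemma submodule_image:
  assumes "module R M" "module R N" "f \<in> mod_hom R M N"
  shows "submodule (f ` carrier M) R N"
proof -
  interpret M: module R M by fact
  interpret N: module R N by fact
  show ?thesis
  proof (rule N.submoduleI)
    show "f ` carrier M \<subseteq> carrier N" using mod_homD(1)[OF assms(3)] by blast
    show "\<zero>\<^bsub>N\<^esub> \<in> f ` carrier M" using mod_hom_zero[OF assms] M.M.zero_closed by (metis imageI)
    show "\<ominus>\<^bsub>N\<^esub> a \<in> f ` carrier M" if "a \<in> f ` carrier M" for a
      using that by (auto simp: mod_hom_minus[OF assms, symmetric])
    show "a \<oplus>\<^bsub>N\<^esub> b \<in> f ` carrier M" if "a \<in> f ` carrier M" "b \<in> f ` carrier M" for a b
      using that by (auto simp: mod_homD(2)[OF assms(3), symmetric])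
    show "a \<odot>\<^bsub>N\<^esub> x \<in> f ` carrier M" if "a \<in> carrier R" "x \<in> f ` carrier M" for a x
      using that by (auto simp: mod_homD(3)[OF assms(3), symmetric])
  qed
qed

text \<open>Transport of structure along a map injective on the carrier. Since
  \<open>injective_module\<close> tests only modules of one carrier type, changes of type are made
  through this construction.\<close>

definition transport :: "('b \<Rightarrow> 'c) \<Rightarrow> ('a, 'b) module \<Rightarrow> ('a, 'c) module" where
  "transport h M = \<lparr>carrier = h ` carrier M, monoid.mult = undefined, one = undefined, zero = h \<zero>\<^bsub>M\<^esub>,
     add = (\<lambda>x y. h (inv_into (carrier M) h x \<oplus>\<^bsub>M\<^esub> inv_into (carrier M) h y)),
     smult = (\<lambda>r x. h (r \<odot>\<^bsub>M\<^esub> inv_into (carrier M) h x))\<rparr>"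

lemma carrier_transport [simp]: "carrier (transport h M) = h ` carrier M"
  by (simp add: transport_def)

lemma
  assumes "module R M" "inj_on h (carrier M)"
  shows module_transport: "module R (transport h M)"
    and transport_hom: "h \<in> mod_hom R M (transport h M)"
    and transport_inv_hom: "inv_into (carrier M) h \<in> mod_hom R (transport h M) M"
proof -
  interpret M: module R M by fact
  have inv: "inv_into (carrier M) h (h x) = x" if "x \<in> carrier M" for x
    using that assms(2) by simp
  have ag: "abelian_group (transport h M)"
  proof (rule abelian_groupI)
    fix x assume "x \<in> carrier (transport h M)"
    then obtain u where u: "x = h u" "u \<in> carrier M" by auto
    show "\<exists>y\<in>carrier (transport h M). y \<oplus>\<^bsub>transport h M\<^esub> x = \<zero>\<^bsub>transport h M\<^esub>"
      by (rule bexI[of _ "h (\<ominus>\<^bsub>M\<^esub> u)"]) (use u in \<open>auto simp: transport_def inv M.M.l_neg\<close>)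
  qed (auto simp: transport_def inv M.M.a_ac)
  show "module R (transport h M)"
    by (rule moduleI[OF M.R.is_cring ag])
      (auto simp: transport_def inv M.smult_l_distr M.smult_r_distr M.smult_assoc1)
  show "h \<in> mod_hom R M (transport h M)"
    by (rule mod_homI) (auto simp: transport_def inv)
  show "inv_into (carrier M) h \<in> mod_hom R (transport h M) M"
    by (rule mod_homI) (auto simp: transport_def inv)
qed

section \<open>Quotients by submodules\<close>

lemma carrier_quotient_module: "carrier (quotient_module R M N) = a_rcosets\<^bsub>M\<^esub> N"
  and zero_quotient_module: "\<zero>\<^bsub>quotient_module R M N\<^esub> = N"
  by (simp_all add: quotient_module_def)

lemma
  assumes "module R M" "submodule N R M"
  shows module_quotient: "module R (quotient_module R M N)"
    and quotient_proj_hom: "(\<lambda>x. N +>\<^bsub>M\<^esub> x) \<in> mod_hom R M (quotient_module R M N)"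
    and quotient_proj_kernel: "x \<in> carrier M \<Longrightarrow> N +>\<^bsub>M\<^esub> x = N \<longleftrightarrow> x \<in> N"
proof -
  interpret M: module R M by fact
  interpret N: submodule N R M by fact
  interpret N: abelian_subgroup N M
    using M.abelian_group_axioms N.subgroup_axioms
    by (intro abelian_subgroupI3 additive_subgroup.intro)
  let ?Q = "quotient_module R M N"
  have Q: "carrier ?Q = {N +>\<^bsub>M\<^esub> x | x. x \<in> carrier M}"
    by (auto simp: carrier_quotient_module A_RCOSETS_def')
  have eq: "N +>\<^bsub>M\<^esub> x = N +>\<^bsub>M\<^esub> y" if "x \<in> N +>\<^bsub>M\<^esub> y" "y \<in> carrier M" for x y
    using N.a_repr_independence'[OF that] by simp
  have add: "(N +>\<^bsub>M\<^esub> x) \<oplus>\<^bsub>?Q\<^esub> (N +>\<^bsub>M\<^esub> y) = N +>\<^bsub>M\<^esub> (x \<oplus>\<^bsub>M\<^esub> y)" if "x \<in> carrier M" "y \<in> carrier M" for x y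
    using that N.a_rcos_sum by (simp add: quotient_module_def)
  have smult: "r \<odot>\<^bsub>?Q\<^esub> (N +>\<^bsub>M\<^esub> x) = N +>\<^bsub>M\<^esub> (r \<odot>\<^bsub>M\<^esub> x)" if "x \<in> carrier M" "r \<in> carrier R" for r x
  proof -
    \<comment> \<open>The scalar multiple of a coset is defined as a union over its elements; the
      union collapses because all its members are the same coset.\<close>
    have const: "N +>\<^bsub>M\<^esub> (r \<odot>\<^bsub>M\<^esub> y) = N +>\<^bsub>M\<^esub> (r \<odot>\<^bsub>M\<^esub> x)" if y: "y \<in> N +>\<^bsub>M\<^esub> x" for y
    proof (rule eq)
      obtain n where n: "n \<in> N" "y = n \<oplus>\<^bsub>M\<^esub> x" using y by (auto simp: a_r_coset_def')
      then have "r \<odot>\<^bsub>M\<^esub> y = r \<odot>\<^bsub>M\<^esub> n \<oplus>\<^bsub>M\<^esub> r \<odot>\<^bsub>M\<^esub> x"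
        using \<open>x \<in> carrier M\<close> \<open>r \<in> carrier R\<close> N.a_subset by (simp add: M.smult_r_distr subset_iff)
      then show "r \<odot>\<^bsub>M\<^esub> y \<in> N +>\<^bsub>M\<^esub> (r \<odot>\<^bsub>M\<^esub> x)"
        using n \<open>r \<in> carrier R\<close> by (auto simp: a_r_coset_def')
    qed (use that in \<open>simp add: \<open>x \<in> carrier M\<close> \<open>r \<in> carrier R\<close>\<close>)
    have "x \<in> N +>\<^bsub>M\<^esub> x" using that by (simp add: N.a_rcos_self)
    then have "(\<Union>y\<in>N +>\<^bsub>M\<^esub> x. N +>\<^bsub>M\<^esub> (r \<odot>\<^bsub>M\<^esub> y)) = N +>\<^bsub>M\<^esub> (r \<odot>\<^bsub>M\<^esub> x)"
      by (intro SUP_eq_const[OF _ const]) blast+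
    then show ?thesis by (simp add: quotient_module_def)
  qed
  have zero: "\<zero>\<^bsub>?Q\<^esub> = N +>\<^bsub>M\<^esub> \<zero>\<^bsub>M\<^esub>"
    using N.a_subset by (simp add: zero_quotient_module)
  have ag: "abelian_group ?Q"
  proof (rule abelian_groupI)
    show "\<zero>\<^bsub>?Q\<^esub> \<in> carrier ?Q" unfolding zero Q by blast
    fix X assume "X \<in> carrier ?Q"
    then obtain u where u: "X = N +>\<^bsub>M\<^esub> u" "u \<in> carrier M" by (auto simp: Q)
    show "\<exists>y\<in>carrier ?Q. y \<oplus>\<^bsub>?Q\<^esub> X = \<zero>\<^bsub>?Q\<^esub>"
      by (rule bexI[of _ "N +>\<^bsub>M\<^esub> (\<ominus>\<^bsub>M\<^esub> u)"]) (use u in \<open>auto simp: Q add zero M.M.l_neg\<close>)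
    show "X \<oplus>\<^bsub>?Q\<^esub> Y \<in> carrier ?Q" if "Y \<in> carrier ?Q" for Y
      using that u by (auto simp: Q add)
    show "\<zero>\<^bsub>?Q\<^esub> \<oplus>\<^bsub>?Q\<^esub> X = X" using u by (simp add: zero add)
  qed (auto simp: Q add M.M.a_ac)
  show "module R ?Q"
  proof (rule moduleI[OF M.R.is_cring ag])
    show "a \<odot>\<^bsub>?Q\<^esub> X \<in> carrier ?Q" if "a \<in> carrier R" "X \<in> carrier ?Q" for a X
      using that by (auto simp: Q smult)
  qed (auto simp: Q smult add M.smult_l_distr M.smult_r_distr M.smult_assoc1)
  show "(\<lambda>x. N +>\<^bsub>M\<^esub> x) \<in> mod_hom R M ?Q"
    by (rule mod_homI) (auto simp: Q smult add)
  show "N +>\<^bsub>M\<^esub> x = N \<longleftrightarrow> x \<in> N" if "x \<in> carrier M"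
    using that N.a_rcos_self by (metis N.a_rcos_const)
qed

section \<open>Divisible hulls\<close>

text \<open>The rational vector space with basis \<open>X\<close>, written multiplicatively so that
  \<open>Mod\<close> and the group-theoretic extension lemma apply. Finite supports keep its
  cardinality under control.\<close>

definition rat_functions :: "'b set \<Rightarrow> ('b \<Rightarrow> rat) monoid" where
  "rat_functions X = \<lparr>carrier = {f. finite {x. f x \<noteq> 0} \<and> {x. f x \<noteq> 0} \<subseteq> X},
     monoid.mult = (\<lambda>f g x. f x + g x), one = (\<lambda>_. 0)\<rparr>"

lemma comm_group_rat_functions: "comm_group (rat_functions X)"
  and inv_rat_functions: "f \<in> carrier (rat_functions X) \<Longrightarrow> inv\<^bsub>rat_functions X\<^esub> f = (\<lambda>x. - f x)"
proof -
  have neg: "(\<lambda>x. - f x) \<in> carrier (rat_functions X)" if "f \<in> carrier (rat_functions X)" for f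
    using that by (simp add: rat_functions_def)
  have add: "(\<lambda>x. f x + g x) \<in> carrier (rat_functions X)"
    if "f \<in> carrier (rat_functions X)" "g \<in> carrier (rat_functions X)" for f g
  proof -
    have "{x. f x + g x \<noteq> 0} \<subseteq> {x. f x \<noteq> 0} \<union> {x. g x \<noteq> 0}" by auto
    then show ?thesis using that by (auto simp: rat_functions_def intro: finite_subset)
  qed
  show cg: "comm_group (rat_functions X)"
  proof (rule comm_groupI)
    show "\<exists>y\<in>carrier (rat_functions X). y \<otimes>\<^bsub>rat_functions X\<^esub> f = \<one>\<^bsub>rat_functions X\<^esub>"
      if "f \<in> carrier (rat_functions X)" for f
      using neg[OF that] by (rule bexI[rotated]) (simp add: rat_functions_def)
    show "f \<otimes>\<^bsub>rat_functions X\<^esub> g \<in> carrier (rat_functions X)"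
      if "f \<in> carrier (rat_functions X)" "g \<in> carrier (rat_functions X)" for f g
      using add[OF that] by (simp add: rat_functions_def)
  qed (auto simp: rat_functions_def add_ac)
  then interpret comm_group "rat_functions X" .
  show "inv\<^bsub>rat_functions X\<^esub> f = (\<lambda>x. - f x)" if "f \<in> carrier (rat_functions X)"
    using that neg[OF that] by (intro inv_equality) (simp_all add: rat_functions_def)
qed

lemma rat_functions_nat_pow: "f [^]\<^bsub>rat_functions X\<^esub> (n::nat) = (\<lambda>x. of_nat n * f x)"
  by (induct n) (simp_all add: rat_functions_def nat_pow_def algebra_simps)

text \<open>
  \<open>\<rat>\<^sup>(\<^sup>N\<^sup>)\<close> modulo the kernel of the evaluation \<open>\<int>\<^sup>(\<^sup>N\<^sup>) \<rightarrow> N\<close> is divisible and contains \<open>N\<close>.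
\<close>

lemma ex_divisible_hull:
  fixes N :: "('b, 'n) monoid_scheme"
  assumes "comm_group N"
  obtains D :: "('b \<Rightarrow> rat) set monoid" and i
  where "comm_group D" "i \<in> hom N D" "inj_on i (carrier N)"
    "\<forall>n::int. \<forall>y\<in>carrier D. n > 0 \<longrightarrow> (\<exists>d\<in>carrier D. d [^]\<^bsub>D\<^esub> n = y)"
    "carrier D \<lesssim> Fpow (carrier N \<times> (UNIV :: rat set))"
proof -
  interpret N: comm_group N by fact
  let ?F = "rat_functions (carrier N)"
  interpret F: comm_group ?F by (rule comm_group_rat_functions)
  define Z where "Z = {f \<in> carrier ?F. \<forall>x. f x \<in> \<int>}"
  \<comment> \<open>The floor reads an integral rational as an integer exponent; \<open>eval\<close>
    is additive on \<open>Z\<close>, where nothing is rounded.\<close>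
  define eval where "eval f = gfinprod N (\<lambda>x. x [^]\<^bsub>N\<^esub> \<lfloor>f x :: rat\<rfloor>) (carrier N)" for f
  have fin: "finite {x \<in> carrier N. x [^]\<^bsub>N\<^esub> \<lfloor>f x\<rfloor> \<noteq> \<one>\<^bsub>N\<^esub>}" if "f \<in> Z" for f
  proof (rule finite_subset)
    show "{x \<in> carrier N. x [^]\<^bsub>N\<^esub> \<lfloor>f x\<rfloor> \<noteq> \<one>\<^bsub>N\<^esub>} \<subseteq> {x. f x \<noteq> 0}" by auto
    show "finite {x. f x \<noteq> 0}" using that by (simp add: Z_def rat_functions_def)
  qed
  have Z_add: "(\<lambda>x. f x + g x) \<in> Z" if "f \<in> Z" "g \<in> Z" for f g
    using that F.m_closed[of f g] by (auto simp: Z_def rat_functions_def)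
  have Z_neg: "(\<lambda>x. - f x) \<in> Z" if "f \<in> Z" for f
    using that by (auto simp: Z_def rat_functions_def)
  have eval_closed: "eval f \<in> carrier N" for f
    unfolding eval_def by (rule N.gfinprod_closed) auto
  have eval_add: "eval (\<lambda>x. f x + g x) = eval f \<otimes>\<^bsub>N\<^esub> eval g" if "f \<in> Z" "g \<in> Z" for f g
  proof -
    have "\<lfloor>f x + g x\<rfloor> = \<lfloor>f x\<rfloor> + \<lfloor>g x\<rfloor>" for x
    proof -
      have "f x \<in> \<int>" "g x \<in> \<int>" using that by (auto simp: Z_def)
      then show ?thesis by (auto elim!: Ints_cases simp flip: of_int_add)
    qed
    then have "eval (\<lambda>x. f x + g x) = gfinprod N (\<lambda>x. x [^]\<^bsub>N\<^esub> \<lfloor>f x\<rfloor> \<otimes>\<^bsub>N\<^esub> x [^]\<^bsub>N\<^esub> \<lfloor>g x\<rfloor>) (carrier N)"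
      unfolding eval_def by (intro N.gfinprod_cong) (auto simp: N.int_pow_mult simp_implies_def)
    also have "\<dots> = eval f \<otimes>\<^bsub>N\<^esub> eval g"
      unfolding eval_def using that by (intro N.gfinprod_distrib fin) auto
    finally show ?thesis .
  qed
  have eval_zero: "eval (\<lambda>_. 0) = \<one>\<^bsub>N\<^esub>" by (simp add: eval_def gfinprod_def)
  have eval_neg: "eval (\<lambda>x. - f x) = inv\<^bsub>N\<^esub> eval f" if "f \<in> Z" for f
    using eval_add[OF Z_neg[OF that] that] eval_zero eval_closed
    by (intro N.inv_equality[symmetric]) simp_all
  define \<delta> where "\<delta> x = (\<lambda>y. if y = x then 1 else 0 :: rat)" for x :: 'b
  have \<delta>_Z: "\<delta> x \<in> Z" if "x \<in> carrier N" for x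
    using that by (auto simp: Z_def rat_functions_def \<delta>_def)
  have \<delta>_eval: "eval (\<delta> x) = x" if "x \<in> carrier N" for x
  proof -
    have "gfinprod N (\<lambda>y. y) {x} = eval (\<delta> x)"
      unfolding eval_def using that by (intro N.gfinprod_mono_neutral_cong_left) (auto simp: \<delta>_def)
    then show ?thesis using that by simp
  qed
  have Z_F: "f \<in> carrier ?F" if "f \<in> Z" for f using that by (simp add: Z_def)
  define K where "K = {f \<in> Z. eval f = \<one>\<^bsub>N\<^esub>}"
  have zero_Z: "(\<lambda>_. 0) \<in> Z" by (simp add: Z_def rat_functions_def)
  have K: "subgroup K ?F"
  proof (rule F.subgroupI)
    show "K \<subseteq> carrier ?F" using Z_F by (auto simp: K_def)
    show "K \<noteq> {}" using zero_Z eval_zero by (auto simp: K_def)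
    show "inv\<^bsub>?F\<^esub> f \<in> K" if "f \<in> K" for f
      using that Z_F by (simp add: K_def inv_rat_functions Z_neg eval_neg)
    show "f \<otimes>\<^bsub>?F\<^esub> g \<in> K" if "f \<in> K" "g \<in> K" for f g
      using that Z_add[of f g] eval_add[of f g] by (simp add: K_def rat_functions_def)
  qed
  then interpret K: subgroup K ?F .
  interpret K: normal K ?F using K by (simp add: F.normal_iff_subgroup)
  let ?D = "?F Mod K"
  interpret D: comm_group ?D by (rule F.abelian_FactGroup[OF K])
  have coset_eq: "K #>\<^bsub>?F\<^esub> f = K #>\<^bsub>?F\<^esub> g \<longleftrightarrow> eval f = eval g" if "f \<in> Z" "g \<in> Z" for f g
  proof -
    have "K #>\<^bsub>?F\<^esub> f = K #>\<^bsub>?F\<^esub> g \<longleftrightarrow> f \<in> K #>\<^bsub>?F\<^esub> g"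
      using that Z_F F.repr_independence[OF _ _ K] F.rcos_self[OF _ K] by metis
    also have "\<dots> \<longleftrightarrow> f \<otimes>\<^bsub>?F\<^esub> inv\<^bsub>?F\<^esub> g \<in> K"
      using that Z_F by (intro K.rcos_module F.is_group) auto
    also have "f \<otimes>\<^bsub>?F\<^esub> inv\<^bsub>?F\<^esub> g = (\<lambda>x. f x + - g x)"
      using that Z_F by (simp add: inv_rat_functions) (simp add: rat_functions_def)
    also have "\<dots> \<in> K \<longleftrightarrow> eval f \<otimes>\<^bsub>N\<^esub> inv\<^bsub>N\<^esub> eval g = \<one>\<^bsub>N\<^esub>"
      using that Z_add[OF that(1) Z_neg[OF that(2)]] eval_add[OF that(1) Z_neg[OF that(2)]]
      by (simp add: K_def eval_neg)
    also have "\<dots> \<longleftrightarrow> eval f = eval g"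
      using eval_closed by (metis N.inv_closed N.inv_equality N.inv_inv N.r_inv)
    finally show ?thesis .
  qed
  \<comment> \<open>\<open>\<delta>\<close> is not additive, but its class modulo \<open>K\<close>
    is: the basis vector of a product and the sum of the two basis vectors have the same value under
    \<open>eval\<close>. Injectivity holds because \<open>eval\<close> recovers \<open>x\<close>
    from \<open>\<delta> x\<close>.\<close>
  define i where "i x = K #>\<^bsub>?F\<^esub> \<delta> x" for x
  have "i \<in> hom N ?D"
  proof (rule homI)
    show "i x \<in> carrier ?D" if "x \<in> carrier N" for x
      using \<delta>_Z[OF that] Z_F by (auto simp: i_def carrier_FactGroup)
    fix x y assume xy: "x \<in> carrier N" "y \<in> carrier N"
    have "i (x \<otimes>\<^bsub>N\<^esub> y) = K #>\<^bsub>?F\<^esub> (\<lambda>z. \<delta> x z + \<delta> y z)"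
      using xy unfolding i_def by (subst coset_eq) (simp_all add: Z_add \<delta>_Z \<delta>_eval eval_add)
    also have "(\<lambda>z. \<delta> x z + \<delta> y z) = \<delta> x \<otimes>\<^bsub>?F\<^esub> \<delta> y" by (simp add: rat_functions_def)
    also have "K #>\<^bsub>?F\<^esub> \<dots> = i x \<otimes>\<^bsub>?D\<^esub> i y"
      unfolding i_def using xy by (intro hom_mult[OF K.r_coset_hom_Mod] Z_F \<delta>_Z)
    finally show "i (x \<otimes>\<^bsub>N\<^esub> y) = i x \<otimes>\<^bsub>?D\<^esub> i y" .
  qed
  moreover have "inj_on i (carrier N)"
    by (rule inj_onI) (simp add: i_def coset_eq \<delta>_Z \<delta>_eval)
  moreover have "\<forall>n::int. \<forall>y\<in>carrier ?D. n > 0 \<longrightarrow> (\<exists>d\<in>carrier ?D. d [^]\<^bsub>?D\<^esub> n = y)"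
  proof (intro allI ballI impI)
    fix n :: int and y assume n: "n > 0" and y: "y \<in> carrier ?D"
    obtain f where f: "f \<in> carrier ?F" "y = K #>\<^bsub>?F\<^esub> f"
      using y by (auto simp: carrier_FactGroup)
    define g where "g = (\<lambda>x. f x / of_int n)"
    have g: "g \<in> carrier ?F" using f(1) by (auto simp: rat_functions_def g_def)
    obtain k where k: "n = int k" using \<open>n > 0\<close> by (metis pos_int_cases)
    have "g [^]\<^bsub>?F\<^esub> n = f"
      using \<open>n > 0\<close> unfolding k int_pow_int rat_functions_nat_pow by (simp add: g_def k fun_eq_iff)
    then have "(K #>\<^bsub>?F\<^esub> g) [^]\<^bsub>?D\<^esub> n = y" using K.FactGroup_int_pow[OF g, of n] f by simp
    then show "\<exists>d\<in>carrier ?D. d [^]\<^bsub>?D\<^esub> n = y" using g by (auto simp: carrier_FactGroup)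
  qed
  \<comment> \<open>A finitely supported function is determined by its finite graph over the
    support, and passing to cosets does not enlarge the set.\<close>
  moreover have "carrier ?D \<lesssim> Fpow (carrier N \<times> (UNIV :: rat set))"
  proof -
    have "carrier ?D \<lesssim> carrier ?F" by (simp add: carrier_FactGroup image_lepoll)
    also have "carrier ?F = {f. f ` carrier N \<subseteq> UNIV \<and> {x. f x \<noteq> 0} \<subseteq> carrier N \<and> finite {x. f x \<noteq> 0}}"
      by (auto simp: rat_functions_def)
    also have "\<dots> \<lesssim> Fpow (carrier N \<times> (UNIV :: rat set))" by (rule lepoll_restricted_funspace)
    finally show ?thesis .
  qed
  ultimately show ?thesis by (rule that[OF D.comm_group_axioms])
qed

text \<open>A countable set injects into \<open>A\<close>, and both the square of an infinite set
  and the collection of its finite subsets are equipotent to it. This bounds a divisible hull by the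
  carrier type of the module it contains.\<close>

lemma Fpow_Times_countable_lepoll:
  assumes "infinite A" "countable B" "X \<subseteq> A"
  shows "Fpow (X \<times> B) \<lesssim> A"
proof -
  have "Fpow (X \<times> B) \<lesssim> Fpow (A \<times> A)"
  proof -
    obtain g where g: "inj_on g B" "g ` B \<subseteq> A"
      using assms(1,2) by (metis countable_def infinite_le_lepoll lepoll_def lepoll_trans subset_UNIV)
    have "inj_on (map_prod id g) (X \<times> B)" using g by (auto simp: inj_on_def)
    then have "inj_on (image (map_prod id g)) (Fpow (X \<times> B))"
      by (rule inj_on_image[OF inj_on_subset]) (auto simp: Fpow_def)
    moreover have "image (map_prod id g) ` Fpow (X \<times> B) \<subseteq> Fpow (A \<times> A)"
      using g assms(3) by (fastforce simp: Fpow_def)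
    ultimately show ?thesis unfolding lepoll_def by blast
  qed
  also have "\<dots> \<approx> A \<times> A"
    using assms(1) by (intro eqpoll_Fpow) (auto dest: finite_cartesian_productD1)
  also have "\<dots> \<approx> A"
    using card_of_Times_same_infinite[OF assms(1)] by (simp add: eqpoll_iff_card_of_ordIso)
  finally show ?thesis .
qed

section \<open>Injective modules and resolutions\<close>

text \<open>The module of additive maps from \<open>R\<close> to \<open>D\<close>, with
  \<open>D\<close> written multiplicatively. Requiring maps to be \<open>extensional\<close> makes
  those that agree on the carrier of \<open>R\<close> equal as elements.\<close>

definition coinduced :: "('a, 'r) ring_scheme \<Rightarrow> ('d, 'n) monoid_scheme \<Rightarrow> ('a, 'a \<Rightarrow> 'd) module" where
  "coinduced R D = \<lparr>carrier = hom (add_monoid R) D \<inter> extensional (carrier R),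
     monoid.mult = undefined, one = undefined, zero = (\<lambda>r\<in>carrier R. \<one>\<^bsub>D\<^esub>),
     add = (\<lambda>f g. \<lambda>r\<in>carrier R. f r \<otimes>\<^bsub>D\<^esub> g r),
     smult = (\<lambda>s f. \<lambda>r\<in>carrier R. f (r \<otimes>\<^bsub>R\<^esub> s))\<rparr>"

lemma coinduced_ext:
  assumes "f \<in> carrier (coinduced R D)" "g \<in> carrier (coinduced R D)"
    and "\<And>r. r \<in> carrier R \<Longrightarrow> f r = g r"
  shows "f = g"
  using assms by (intro extensionalityI[of _ "carrier R"]) (auto simp: coinduced_def)

lemma in_coinduced:
  assumes "\<And>r. r \<in> carrier R \<Longrightarrow> u r \<in> carrier D"
    and "\<And>r s. r \<in> carrier R \<Longrightarrow> s \<in> carrier R \<Longrightarrow> u (r \<oplus>\<^bsub>R\<^esub> s) = u r \<otimes>\<^bsub>D\<^esub> u s"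
    and "ring R"
  shows "(\<lambda>r\<in>carrier R. u r) \<in> carrier (coinduced R D)"
proof -
  interpret ring R by fact
  show ?thesis using assms by (auto simp: coinduced_def hom_def)
qed

lemma coinducedD:
  assumes "f \<in> carrier (coinduced R D)"
  shows "r \<in> carrier R \<Longrightarrow> f r \<in> carrier D"
    and "r \<in> carrier R \<Longrightarrow> s \<in> carrier R \<Longrightarrow> f (r \<oplus>\<^bsub>R\<^esub> s) = f r \<otimes>\<^bsub>D\<^esub> f s"
  using assms by (auto simp: coinduced_def hom_def)

lemma coinduced_apply:
  assumes "r \<in> carrier R"
  shows "\<zero>\<^bsub>coinduced R D\<^esub> r = \<one>\<^bsub>D\<^esub>"
    and "(f \<oplus>\<^bsub>coinduced R D\<^esub> g) r = f r \<otimes>\<^bsub>D\<^esub> g r"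
    and "(s \<odot>\<^bsub>coinduced R D\<^esub> f) r = f (r \<otimes>\<^bsub>R\<^esub> s)"
  using assms by (simp_all add: coinduced_def)

lemma module_coinduced:
  assumes "cring R" "comm_group D"
  shows "module R (coinduced R D)"
proof -
  interpret R: cring R by fact
  interpret D: comm_group D by fact
  let ?C = "coinduced R D"
  have zero: "\<zero>\<^bsub>?C\<^esub> \<in> carrier ?C"
    using in_coinduced[of R "\<lambda>_. \<one>\<^bsub>D\<^esub>" D] R.ring_axioms by (simp add: coinduced_def)
  have add: "f \<oplus>\<^bsub>?C\<^esub> g \<in> carrier ?C" if "f \<in> carrier ?C" "g \<in> carrier ?C" for f g
    using in_coinduced[of R "\<lambda>r. f r \<otimes>\<^bsub>D\<^esub> g r" D] R.ring_axioms coinducedD[OF that(1)] coinducedD[OF that(2)]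
    by (simp add: coinduced_def D.m_ac)
  have smult: "s \<odot>\<^bsub>?C\<^esub> f \<in> carrier ?C" if "s \<in> carrier R" "f \<in> carrier ?C" for f s
    using in_coinduced[of R "\<lambda>r. f (r \<otimes>\<^bsub>R\<^esub> s)" D] R.ring_axioms coinducedD[OF that(2)] that(1)
    by (simp add: coinduced_def R.l_distr)
  note simps = coinduced_apply coinducedD add zero smult
  have ag: "abelian_group ?C"
  proof (rule abelian_groupI)
    fix f assume f: "f \<in> carrier ?C"
    let ?g = "\<lambda>r\<in>carrier R. inv\<^bsub>D\<^esub> f r"
    have g: "?g \<in> carrier ?C"
      using coinducedD[OF f] R.ring_axioms by (intro in_coinduced) (auto simp: D.inv_mult)
    moreover have "?g \<oplus>\<^bsub>?C\<^esub> f = \<zero>\<^bsub>?C\<^esub>"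
      using g f by (intro coinduced_ext[of _ R D]) (simp_all add: simps)
    ultimately show "\<exists>y\<in>carrier ?C. y \<oplus>\<^bsub>?C\<^esub> f = \<zero>\<^bsub>?C\<^esub>" by blast
    show "\<zero>\<^bsub>?C\<^esub> \<oplus>\<^bsub>?C\<^esub> f = f" using f by (intro coinduced_ext[of _ R D]) (simp_all add: simps)
    fix g assume g: "g \<in> carrier ?C"
    show "f \<oplus>\<^bsub>?C\<^esub> g = g \<oplus>\<^bsub>?C\<^esub> f"
      using f g by (intro coinduced_ext[of _ R D]) (simp_all add: simps D.m_comm)
    fix h assume h: "h \<in> carrier ?C"
    show "f \<oplus>\<^bsub>?C\<^esub> g \<oplus>\<^bsub>?C\<^esub> h = f \<oplus>\<^bsub>?C\<^esub> (g \<oplus>\<^bsub>?C\<^esub> h)"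
      using f g h by (intro coinduced_ext[of _ R D]) (simp_all add: simps D.m_assoc)
  qed (fact zero add)+
  show ?thesis
  proof (rule moduleI[OF assms(1) ag smult])
    fix a b f assume ab: "a \<in> carrier R" "b \<in> carrier R" and f: "f \<in> carrier ?C"
    show "(a \<oplus>\<^bsub>R\<^esub> b) \<odot>\<^bsub>?C\<^esub> f = a \<odot>\<^bsub>?C\<^esub> f \<oplus>\<^bsub>?C\<^esub> b \<odot>\<^bsub>?C\<^esub> f"
      using ab f by (intro coinduced_ext[of _ R D]) (simp_all add: simps R.r_distr)
    show "a \<otimes>\<^bsub>R\<^esub> b \<odot>\<^bsub>?C\<^esub> f = a \<odot>\<^bsub>?C\<^esub> (b \<odot>\<^bsub>?C\<^esub> f)"
      using ab f by (intro coinduced_ext[of _ R D]) (simp_all add: simps R.m_ac)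
  next
    fix a f g assume "a \<in> carrier R" "f \<in> carrier ?C" "g \<in> carrier ?C"
    then show "a \<odot>\<^bsub>?C\<^esub> (f \<oplus>\<^bsub>?C\<^esub> g) = a \<odot>\<^bsub>?C\<^esub> f \<oplus>\<^bsub>?C\<^esub> a \<odot>\<^bsub>?C\<^esub> g"
      by (intro coinduced_ext[of _ R D]) (simp_all add: simps)
  next
    fix f assume "f \<in> carrier ?C"
    then show "\<one>\<^bsub>R\<^esub> \<odot>\<^bsub>?C\<^esub> f = f" by (intro coinduced_ext[of _ R D]) (simp_all add: simps)
  qed
qed

text \<open>The adjunct of the additive map \<open>u\<close>. The opposite direction of the
  adjunction is evaluation at the identity of \<open>R\<close>.\<close>

lemma hom_to_coinduced:
  assumes "module R B" "u \<in> hom (add_monoid B) D"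
  shows "(\<lambda>b. \<lambda>r\<in>carrier R. u (r \<odot>\<^bsub>B\<^esub> b)) \<in> mod_hom R B (coinduced R D)"
proof -
  interpret B: module R B by fact
  have u: "u x \<in> carrier D" "u (x \<oplus>\<^bsub>B\<^esub> y) = u x \<otimes>\<^bsub>D\<^esub> u y" if "x \<in> carrier B" "y \<in> carrier B" for x y
    using assms(2) that by (auto simp: hom_def)
  have C: "(\<lambda>r\<in>carrier R. u (r \<odot>\<^bsub>B\<^esub> b)) \<in> carrier (coinduced R D)" if "b \<in> carrier B" for b
    using that B.R.ring_axioms by (intro in_coinduced) (auto simp: u B.smult_l_distr)
  show ?thesis
  proof (rule mod_homI[OF C])
    fix x y assume "x \<in> carrier B" "y \<in> carrier B"
    then show "(\<lambda>r\<in>carrier R. u (r \<odot>\<^bsub>B\<^esub> (x \<oplus>\<^bsub>B\<^esub> y))) =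
        (\<lambda>r\<in>carrier R. u (r \<odot>\<^bsub>B\<^esub> x)) \<oplus>\<^bsub>coinduced R D\<^esub> (\<lambda>r\<in>carrier R. u (r \<odot>\<^bsub>B\<^esub> y))"
      by (auto simp: coinduced_def u B.smult_r_distr)
  next
    fix s x assume "s \<in> carrier R" "x \<in> carrier B"
    then show "(\<lambda>r\<in>carrier R. u (r \<odot>\<^bsub>B\<^esub> (s \<odot>\<^bsub>B\<^esub> x))) =
        s \<odot>\<^bsub>coinduced R D\<^esub> (\<lambda>r\<in>carrier R. u (r \<odot>\<^bsub>B\<^esub> x))"
      by (auto simp: coinduced_def B.smult_assoc1)
  qed
qed

text \<open>
  \<open>Hom\<^sub>\<int>(R, D)\<close> is right adjoint to the forgetful functor, so it inherits injectivity from \<open>D\<close>.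
\<close>

lemma coinduced_extension:
  assumes "module R A" "module R B" "comm_group D"
    and j: "j \<in> mod_hom R A B" "inj_on j (carrier A)"
    and f: "f \<in> mod_hom R A (coinduced R D)"
    and divisible: "\<And>n y. (n::int) > 0 \<Longrightarrow> y \<in> carrier D \<Longrightarrow> \<exists>d\<in>carrier D. d [^]\<^bsub>D\<^esub> n = y"
  shows "\<exists>g\<in>mod_hom R B (coinduced R D). \<forall>x\<in>carrier A. g (j x) = f x"
proof -
  interpret A: module R A by fact
  interpret B: module R B by fact
  interpret D: comm_group D by fact
  note jD = mod_homD[OF j(1)] and fD = mod_homD[OF f]
  \<comment> \<open>Evaluating at the identity reduces the problem to extending an additive map into
    \<open>D\<close>; the adjunct of that extension is the required linear map.\<close>
  have "(\<lambda>x. f x \<one>\<^bsub>R\<^esub>) \<in> hom (add_monoid A) D"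
    by (rule homI) (auto simp: fD coinducedD[OF fD(1)] coinduced_apply)
  moreover have "j \<in> hom (add_monoid A) (add_monoid B)" by (rule homI) (auto simp: jD)
  ultimately obtain u where u: "u \<in> hom (add_monoid B) D" "\<And>x. x \<in> carrier A \<Longrightarrow> u (j x) = f x \<one>\<^bsub>R\<^esub>"
    using divisible_extension[OF A.a_comm_group B.a_comm_group assms(3), of j "\<lambda>x. f x \<one>\<^bsub>R\<^esub>"]
      j(2) divisible by auto
  let ?g = "\<lambda>b. \<lambda>r\<in>carrier R. u (r \<odot>\<^bsub>B\<^esub> b)"
  have g: "?g \<in> mod_hom R B (coinduced R D)" by (rule hom_to_coinduced) fact+
  have eq: "?g (j x) = f x" if x: "x \<in> carrier A" for x
  proof (rule coinduced_ext[of _ R D])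
    fix r assume r: "r \<in> carrier R"
    have "u (r \<odot>\<^bsub>B\<^esub> j x) = f (r \<odot>\<^bsub>A\<^esub> x) \<one>\<^bsub>R\<^esub>" using r x by (simp add: u(2) flip: jD(3))
    also have "\<dots> = f x r" using r x by (simp add: fD coinduced_apply)
    finally show "?g (j x) r = f x r" using r by simp
  qed (use x in \<open>simp_all add: fD mod_homD[OF g] jD del: restrict_apply\<close>)
  show ?thesis
  proof (intro bexI[OF _ g] ballI)
    fix x assume "x \<in> carrier A"
    then show "?g (j x) = f x" by (rule eq)
  qed
qed

text \<open>\<open>E\<close> lives in \<open>'c\<close> but is to be tested against modules in
  \<open>'b\<close>, which \<open>injective_module R E\<close> cannot express; hence the extension
  property appears as a separate hypothesis, and the isomorphism \<open>h\<close> carries it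
  over.\<close>

lemma injective_module_transport:
  fixes E :: "('a, 'c) module" and h :: "'c \<Rightarrow> 'b"
  assumes "module R E" and h: "inj_on h (carrier E)"
    and ext: "\<And>(A :: ('a, 'b) module) (B :: ('a, 'b) module) j f. module R A \<Longrightarrow> module R B \<Longrightarrow>
      j \<in> mod_hom R A B \<Longrightarrow> inj_on j (carrier A) \<Longrightarrow> f \<in> mod_hom R A E \<Longrightarrow>
      \<exists>g\<in>mod_hom R B E. \<forall>x\<in>carrier A. g (j x) = f x"
  shows "injective_module R (transport h E)"
  unfolding injective_module_def
proof (intro conjI allI impI)
  show "module R (transport h E)" using assms by (intro module_transport)
  fix A B :: "('a, 'b) module" and j f
  assume *: "module R A" "module R B" "j \<in> mod_hom R A B" "inj_on j (carrier A)"
    and f: "f \<in> mod_hom R A (transport h E)"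
  have "(\<lambda>x. inv_into (carrier E) h (f x)) \<in> mod_hom R A E"
    using f transport_inv_hom[OF assms(1) h] by (rule mod_hom_comp)
  then obtain g where g: "g \<in> mod_hom R B E" "\<forall>x\<in>carrier A. g (j x) = inv_into (carrier E) h (f x)"
    using ext[OF *] by blast
  have "(\<lambda>x. h (g x)) \<in> mod_hom R B (transport h E)"
    using g(1) transport_hom[OF assms(1) h] by (rule mod_hom_comp)
  moreover have "h (g (j x)) = f x" if "x \<in> carrier A" for x
    using that g(2) mod_homD(1)[OF f] by (simp add: f_inv_into_f)
  ultimately show "\<exists>g\<in>mod_hom R B (transport h E). \<forall>x\<in>carrier A. g (j x) = f x"
    by (intro bexI[of _ "\<lambda>x. h (g x)"] ballI)
qed

text \<open>An embedding of \<open>N\<close> into a divisible group \<open>D\<close> has as adjunct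
  an embedding into the additive maps from \<open>R\<close> to \<open>D\<close>. The point is to
  stay in the same carrier type: \<open>D\<close> fits by cardinality, and the coinduced module fits
  by the explicit coding \<open>\<Phi>\<close>.\<close>

lemma ex_injective_embedding:
  fixes R :: "('a, 'r) ring_scheme" and N :: "('a, ('a, 'm) resolution_type) module"
  assumes "module R N"
  shows "\<exists>(E :: ('a, ('a, 'm) resolution_type) module) h.
    injective_module R E \<and> h \<in> mod_hom R N E \<and> inj_on h (carrier N)"
proof -
  interpret N: module R N by fact
  obtain D :: "(('a, 'm) resolution_type \<Rightarrow> rat) set monoid" and i where D: "comm_group D"
    and i: "i \<in> hom (add_monoid N) D" "inj_on i (carrier (add_monoid N))"
    and divisible: "\<forall>n::int. \<forall>y\<in>carrier D. n > 0 \<longrightarrow> (\<exists>d\<in>carrier D. d [^]\<^bsub>D\<^esub> n = y)"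
    and D_card: "carrier D \<lesssim> Fpow (carrier (add_monoid N) \<times> (UNIV :: rat set))"
    by (rule ex_divisible_hull[OF N.M.a_comm_group]) (rule that)
  have "infinite (UNIV :: ('a, 'm) resolution_type set)"
    by (simp add: Finite_Set.finite_set infinite_UNIV_listI)
  then have "Fpow (carrier (add_monoid N) \<times> (UNIV :: rat set)) \<lesssim> (UNIV :: ('a, 'm) resolution_type set)"
    by (intro Fpow_Times_countable_lepoll) auto
  with D_card have "carrier D \<lesssim> (UNIV :: ('a, 'm) resolution_type set)" by (rule lepoll_trans)
  then obtain \<phi> :: "_ \<Rightarrow> ('a, 'm) resolution_type" where \<phi>: "inj_on \<phi> (carrier D)"
    by (auto simp: lepoll_def)
  let ?C = "coinduced R D"
  have C: "module R ?C" using N.R.is_cring D by (rule module_coinduced)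
  \<comment> \<open>The values of \<open>f\<close> are coded as sets of lists, and the lists in the
    value at \<open>r\<close> are prefixed with the letter \<open>Inl r\<close>. Stripping that
    letter recovers each value, so a whole function becomes a single element of the type.\<close>
  define \<Phi> where "\<Phi> f = {Inl r # l | r l. r \<in> carrier R \<and> l \<in> \<phi> (f r)}" for f
  have \<Phi>: "inj_on \<Phi> (carrier ?C)"
  proof (rule inj_onI)
    fix f g assume fg: "f \<in> carrier ?C" "g \<in> carrier ?C" "\<Phi> f = \<Phi> g"
    have eq: "\<phi> (f r) = \<phi> (g r)" if "r \<in> carrier R" for r
    proof -
      have "l \<in> \<phi> (h r) \<longleftrightarrow> Inl r # l \<in> \<Phi> h" for l h using that by (auto simp: \<Phi>_def)
      then show ?thesis using fg(3) by auto
    qed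
    show "f = g"
      using fg eq by (intro coinduced_ext[OF fg(1,2)] inj_onD[OF \<phi>]) (simp_all add: coinducedD)
  qed
  let ?h = "\<lambda>x. \<lambda>r\<in>carrier R. i (r \<odot>\<^bsub>N\<^esub> x)"
  have h: "?h \<in> mod_hom R N ?C" using assms i(1) by (rule hom_to_coinduced)
  have "inj_on ?h (carrier N)"
  proof (rule inj_onI)
    fix x y assume xy: "x \<in> carrier N" "y \<in> carrier N" and eq: "?h x = ?h y"
    have "i x = i y" using fun_cong[OF eq, of "\<one>\<^bsub>R\<^esub>"] xy by simp
    then show "x = y" using xy i(2) by (simp add: inj_on_def)
  qed
  then have "inj_on (\<lambda>x. \<Phi> (?h x)) (carrier N)"
    using \<Phi> mod_homD(1)[OF h] by (auto simp: inj_on_def)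
  moreover have "(\<lambda>x. \<Phi> (?h x)) \<in> mod_hom R N (transport \<Phi> ?C)"
    using h transport_hom[OF C \<Phi>] by (rule mod_hom_comp)
  moreover have "injective_module R (transport \<Phi> ?C)"
    using C \<Phi> coinduced_extension[OF _ _ D _ _ _ divisible[rule_format]] by (rule injective_module_transport)
  ultimately show ?thesis by (intro exI conjI)
qed

lemma mod_hom_eq_zero_iff:
  assumes "module R M" "module R N" "f \<in> mod_hom R M N" "inj_on f (carrier M)" "x \<in> carrier M"
  shows "f x = \<zero>\<^bsub>N\<^esub> \<longleftrightarrow> x = \<zero>\<^bsub>M\<^esub>"
proof -
  interpret M: module R M by fact
  show ?thesis using assms mod_hom_zero[OF assms(1-3)] by (metis M.M.zero_closed inj_onD)
qed

text \<open>One step of a resolution: project to the quotient by \<open>S\<close> and embed that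
  quotient into an injective module.\<close>

lemma ex_injective_hom_with_kernel:
  fixes R :: "('a, 'r) ring_scheme" and N :: "('a, ('a, 'm) resolution_type) module"
  assumes N: "module R N" and S: "submodule S R N"
  shows "\<exists>(E :: ('a, ('a, 'm) resolution_type) module) d.
    injective_module R E \<and> d \<in> mod_hom R N E \<and> {x \<in> carrier N. d x = \<zero>\<^bsub>E\<^esub>} = S"
proof -
  let ?Q = "quotient_module R N S" and ?p = "\<lambda>x. S +>\<^bsub>N\<^esub> x"
  \<comment> \<open>Cosets are sets of elements of the resolution type; choosing a representative of
    each brings the quotient back into that type.\<close>
  let ?s = "inv_into (carrier N) ?p"
  have Q: "module R ?Q" using assms by (rule module_quotient)
  have p: "?p \<in> mod_hom R N ?Q" using assms by (rule quotient_proj_hom)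
  have "carrier ?Q = ?p ` carrier N" by (auto simp: carrier_quotient_module A_RCOSETS_def')
  then have s: "inj_on ?s (carrier ?Q)" by (auto intro: inj_on_inv_into)
  note T = module_transport[OF Q s]
  obtain E h where E: "injective_module R (E :: ('a, ('a, 'm) resolution_type) module)"
    and h: "h \<in> mod_hom R (transport ?s ?Q) E" "inj_on h (carrier (transport ?s ?Q))"
    using ex_injective_embedding[OF T] by blast
  have E': "module R E" using E by (simp add: injective_module_def)
  define d where "d x = h (?s (?p x))" for x
  have sp: "(\<lambda>x. ?s (?p x)) \<in> mod_hom R N (transport ?s ?Q)"
    using p transport_hom[OF Q s] by (rule mod_hom_comp)
  then have "d \<in> mod_hom R N E" unfolding d_def using h(1) by (rule mod_hom_comp)
  moreover have "d x = \<zero>\<^bsub>E\<^esub> \<longleftrightarrow> x \<in> S" if "x \<in> carrier N" for x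
    using that mod_homD(1)[OF sp] mod_homD(1)[OF p] quotient_proj_kernel[OF N S]
    by (simp add: d_def mod_hom_eq_zero_iff[OF T E' h] mod_hom_eq_zero_iff[OF Q T transport_hom[OF Q s] s]
        zero_quotient_module del: carrier_transport)
  moreover have "S \<subseteq> carrier N" using module.submoduleE(1)[OF N S] .
  ultimately show ?thesis using E by blast
qed

lemma ex_injective_resolution:
  fixes R :: "('a, 'r) ring_scheme" and M :: "('a, 'm) module"
  assumes M: "module R M"
  shows "\<exists>(E :: nat \<Rightarrow> ('a, ('a, 'm) resolution_type) module) \<epsilon> d. injective_resolution R M E \<epsilon> d"
proof -
  let ?s = "\<lambda>x. {[Inr x]} :: ('a, 'm) resolution_type"
  have s: "inj_on ?s (carrier M)" by (auto intro: inj_onI)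
  note T = module_transport[OF M s]
  obtain E0 h where E0: "injective_module R (E0 :: ('a, ('a, 'm) resolution_type) module)"
    and h: "h \<in> mod_hom R (transport ?s M) E0" "inj_on h (carrier (transport ?s M))"
    using ex_injective_embedding[OF T] by blast
  define \<epsilon> where "\<epsilon> x = h (?s x)" for x
  have \<epsilon>: "\<epsilon> \<in> mod_hom R M E0" unfolding \<epsilon>_def using transport_hom[OF M s] h(1) by (rule mod_hom_comp)
  have inj: "inj_on \<epsilon> (carrier M)" using h(2) by (auto simp: \<epsilon>_def inj_on_def)
  \<comment> \<open>The state at stage \<open>n\<close> is an injective module with the submodule
    that the next differential must have as its kernel, namely the image of the preceding map. The
    clause for \<open>n = 0\<close> pins down the start, so that exactness at \<open>E 0\<close> can
    be read off.\<close>
  define P where "P n x \<longleftrightarrow> injective_module R (fst x) \<and> submodule (snd x) R (fst x) \<and>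
      (n = 0 \<longrightarrow> x = (E0, \<epsilon> ` carrier M))" for n :: nat and x :: "('a, ('a, 'm) resolution_type) module \<times> _"
  define Q where "Q x y d \<longleftrightarrow> d \<in> mod_hom R (fst x) (fst y) \<and>
      {z \<in> carrier (fst x). d z = \<zero>\<^bsub>fst y\<^esub>} = snd x \<and> d ` carrier (fst x) = snd y"
    for x y :: "('a, ('a, 'm) resolution_type) module \<times> _" and d
  have "\<exists>F. \<forall>n. P n (F n) \<and> (\<exists>d. Q (F n) (F (Suc n)) d)"
  proof (rule dependent_nat_choice)
    show "\<exists>x. P 0 x"
      using E0 submodule_image[OF M _ \<epsilon>] by (auto simp: P_def injective_module_def)
    fix x n assume x: "P n x"
    then have mx: "module R (fst x)" by (simp add: P_def injective_module_def)
    with x obtain E d where E: "injective_module R (E :: ('a, ('a, 'm) resolution_type) module)"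
      and d: "d \<in> mod_hom R (fst x) E" "{z \<in> carrier (fst x). d z = \<zero>\<^bsub>E\<^esub>} = snd x"
      using ex_injective_hom_with_kernel[of R "fst x" "snd x"] by (auto simp: P_def)
    then have "submodule (d ` carrier (fst x)) R E"
      using mx by (intro submodule_image) (simp_all add: injective_module_def)
    then have "P (Suc n) (E, d ` carrier (fst x)) \<and> Q x (E, d ` carrier (fst x)) d"
      using E d by (simp add: P_def Q_def)
    then show "\<exists>y. P (Suc n) y \<and> (\<exists>d. Q x y d)" by blast
  qed
  then obtain F d where F: "\<And>n. P n (F n)" and d: "\<And>n. Q (F n) (F (Suc n)) (d n)" by metis
  have "injective_resolution R M (\<lambda>n. fst (F n)) \<epsilon> d"
    unfolding injective_resolution_def
  proof (intro conjI allI)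
    have F0: "F 0 = (E0, \<epsilon> ` carrier M)" using F[of 0] by (simp add: P_def)
    show "\<epsilon> \<in> mod_hom R M (fst (F 0))" using \<epsilon> F0 by simp
    show "\<epsilon> ` carrier M = {x \<in> carrier (fst (F 0)). d 0 x = \<zero>\<^bsub>fst (F 1)\<^esub>}"
      using d[of 0] F0 by (simp add: Q_def)
    fix n
    show "injective_module R (fst (F n))" using F by (simp add: P_def)
    show "d n \<in> mod_hom R (fst (F n)) (fst (F (Suc n)))" using d by (simp add: Q_def)
    show "d n ` carrier (fst (F n)) = {x \<in> carrier (fst (F (Suc n))). d (Suc n) x = \<zero>\<^bsub>fst (F (Suc (Suc n)))\<^esub>}"
      using d[of n] d[of "Suc n"] by (simp add: Q_def)
  qed (fact inj)
  then show ?thesis by blast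
qed

text \<open>Frees the extension property from the carrier type of \<open>E\<close>: one injection
  \<open>h\<close> of the carrier of \<open>B\<close> suffices, because \<open>A\<close> can be
  transported along the composite of \<open>j\<close> and \<open>h\<close>.\<close>

lemma injective_module_extension:
  fixes E :: "('a, 'b) module" and A :: "('a, 'x) module" and B :: "('a, 'y) module"
    and h :: "'y \<Rightarrow> 'b"
  assumes E: "injective_module R E" and A: "module R A" and B: "module R B"
    and j: "j \<in> mod_hom R A B" "inj_on j (carrier A)" and f: "f \<in> mod_hom R A E"
    and h: "inj_on h (carrier B)"
  obtains g where "g \<in> mod_hom R B E" "\<And>x. x \<in> carrier A \<Longrightarrow> g (j x) = f x"
proof -
  let ?k = "\<lambda>x. h (j x)"
  have k: "inj_on ?k (carrier A)"
    using j(2) h mod_homD(1)[OF j(1)] by (simp add: inj_on_def)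
  let ?i = "inv_into (carrier A) ?k"
  have i: "?i \<in> mod_hom R (transport ?k A) A" using A k by (rule transport_inv_hom)
  have inv: "?i (?k x) = x" if "x \<in> carrier A" for x
    by (rule inv_into_f_f[OF k that])
  have "(\<lambda>x. ?k (?i x)) \<in> mod_hom R (transport ?k A) (transport h B)"
    by (rule mod_hom_comp[OF mod_hom_comp[OF i j(1)] transport_hom[OF B h]])
  moreover have "inj_on (\<lambda>x. ?k (?i x)) (carrier (transport ?k A))"
    by (auto simp: inj_on_def inv)
  moreover have "(\<lambda>x. f (?i x)) \<in> mod_hom R (transport ?k A) E"
    using i f by (rule mod_hom_comp)
  ultimately have "\<exists>g\<in>mod_hom R (transport h B) E. \<forall>x\<in>carrier (transport ?k A). g (?k (?i x)) = f (?i x)"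
    using E module_transport[OF A k] module_transport[OF B h] unfolding injective_module_def by blast
  then obtain g where g: "g \<in> mod_hom R (transport h B) E"
      "\<And>x. x \<in> carrier (transport ?k A) \<Longrightarrow> g (?k (?i x)) = f (?i x)" by auto
  show ?thesis
  proof (rule that)
    show "(\<lambda>x. g (h x)) \<in> mod_hom R B E" using transport_hom[OF B h] g(1) by (rule mod_hom_comp)
    show "g (h (j x)) = f x" if "x \<in> carrier A" for x
      using g(2)[of "?k x"] that by (simp add: inv)
  qed
qed

text \<open>Negatives come from the scalar \<open>\<ominus> \<one>\<close>.\<close>

lemma (in module) submoduleI_smult:
  assumes "H \<subseteq> carrier M" "\<zero>\<^bsub>M\<^esub> \<in> H" "\<And>a b. a \<in> H \<Longrightarrow> b \<in> H \<Longrightarrow> a \<oplus>\<^bsub>M\<^esub> b \<in> H"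
    and smult: "\<And>a x. a \<in> carrier R \<Longrightarrow> x \<in> H \<Longrightarrow> a \<odot>\<^bsub>M\<^esub> x \<in> H"
  shows "submodule H R M"
proof (rule submoduleI)
  show "\<ominus>\<^bsub>M\<^esub> x \<in> H" if "x \<in> H" for x
    using smult[OF _ that, of "\<ominus> \<one>"] that assms(1) by (simp add: smult_l_minus subset_iff)
qed (use assms in auto)

section \<open>The ring and its ideals as modules\<close>

lemma (in cring) module_ring: "module R (ideal_module R (carrier R))"
proof (rule moduleI[OF is_cring])
  show "abelian_group (ideal_module R (carrier R))"
    by (rule abelian_groupI) (auto simp: ideal_module_def a_ac intro: bexI[of _ "\<ominus> x" for x] l_neg)
qed (auto simp: ideal_module_def l_distr r_distr m_assoc)

lemma (in cring) module_ideal: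
  assumes "ideal I R"
  shows "module R (ideal_module R I)"
proof -
  interpret I: ideal I R by fact
  interpret M: module R "ideal_module R (carrier R)" by (rule module_ring)
  have "submodule I R (ideal_module R (carrier R))"
    by (rule M.submoduleI_smult) (auto simp: ideal_module_def I.a_closed I.I_l_closed I.Icarr)
  then have "module R (ideal_module R (carrier R)\<lparr>carrier := I\<rparr>)"
    using module_ring by (rule submodule.submodule_is_module)
  then show ?thesis by (simp add: ideal_module_def)
qed

section \<open>Torsion cohomology in degree one\<close>

lemma (in cring) idempotent_ideal_pow:
  fixes n :: nat
  assumes "ideal I R" "I \<cdot> I = I" "n \<ge> 1"
  shows "I [^]\<^bsub>ideals_set R\<^esub> n = I"
proof -
  interpret S: comm_monoid "ideals_set R" by (rule ideals_set_is_comm_monoid)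
  have I: "I \<in> carrier (ideals_set R)" "I \<otimes>\<^bsub>ideals_set R\<^esub> I = I"
    using assms by (simp_all add: ideals_set_def)
  from \<open>n \<ge> 1\<close> show ?thesis by (induct n rule: dec_induct) (simp_all add: I)
qed

lemma (in cring) torsion_idempotent_ideal:
  assumes "ideal I R" "I \<cdot> I = I"
  shows "carrier (torsion_module R I M) = {x \<in> carrier M. \<forall>a\<in>I. a \<odot>\<^bsub>M\<^esub> x = \<zero>\<^bsub>M\<^esub>}"
  using idempotent_ideal_pow[OF assms] idempotent_ideal_pow[OF assms, of 1]
  by (auto simp: torsion_module_def intro!: exI[of _ "1 :: nat"])

text \<open>Idempotence of \<open>I\<close> turns torsion into annihilation by \<open>I\<close>, so
  a nonzero class is a cocycle \<open>z\<close> killed by \<open>I\<close> that is not the image of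
  an element killed by \<open>I\<close>. The premise quantifies over all resolutions because the one
  used by \<open>derived_torsion\<close> is an arbitrary choice.\<close>

lemma nonzero_derived_torsionI:
  fixes M :: "('a, 'm) module" and R :: "('a, 'r) ring_scheme"
  assumes M: "module R M" and I: "ideal I R" "ideal_prod R I I = I"
    and nontrivial: "\<And>(E :: nat \<Rightarrow> ('a, ('a, 'm) resolution_type) module) \<epsilon> d. injective_resolution R M E \<epsilon> d \<Longrightarrow>
      \<exists>z\<in>carrier (E (Suc i)). d (Suc i) z = \<zero>\<^bsub>E (Suc (Suc i))\<^esub> \<and>
        (\<forall>a\<in>I. a \<odot>\<^bsub>E (Suc i)\<^esub> z = \<zero>\<^bsub>E (Suc i)\<^esub>) \<and>
        \<not> (\<exists>y\<in>carrier (E i). (\<forall>a\<in>I. a \<odot>\<^bsub>E i\<^esub> y = \<zero>\<^bsub>E i\<^esub>) \<and> d i y = z)"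
  shows "nonzero_module (derived_torsion R I (Suc i) M)"
proof -
  interpret M: module R M by fact
  obtain E :: "nat \<Rightarrow> ('a, ('a, 'm) resolution_type) module" and \<epsilon> d
    where res: "injective_resolution R M E \<epsilon> d"
      and eq: "derived_torsion R I (Suc i) M = cohomology R (\<lambda>n. torsion_module R I (E n)) d (Suc i)"
  proof -
    let ?P = "\<lambda>(E :: nat \<Rightarrow> ('a, ('a, 'm) resolution_type) module, \<epsilon>, d). injective_resolution R M E \<epsilon> d"
    obtain E \<epsilon> d where E: "(SOME x. ?P x) = (E, \<epsilon>, d)" by (cases "SOME x. ?P x")
    \<comment> \<open>Only existence makes the chosen triple a resolution at all.\<close>
    have "\<exists>x. ?P x" using ex_injective_resolution[OF M] by auto
    then have "?P (SOME x. ?P x)" by (rule someI_ex)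
    then show ?thesis using that[of E \<epsilon> d] by (simp add: E derived_torsion_def)
  qed
  have E: "module R (E n)" for n using res by (simp add: injective_resolution_def injective_module_def)
  have d: "d n \<in> mod_hom R (E n) (E (Suc n))" for n using res by (simp add: injective_resolution_def)
  let ?C = "\<lambda>n. torsion_module R I (E n)"
  have C: "zero (?C n) = zero (E n)" "add (?C n) = add (E n)" for n
    by (simp_all add: torsion_module_def)
  note car = M.R.torsion_idempotent_ideal[OF I]
  obtain z where z: "z \<in> carrier (E (Suc i))" "d (Suc i) z = \<zero>\<^bsub>E (Suc (Suc i))\<^esub>"
      "\<forall>a\<in>I. a \<odot>\<^bsub>E (Suc i)\<^esub> z = \<zero>\<^bsub>E (Suc i)\<^esub>"
      "\<not> (\<exists>y\<in>carrier (E i). (\<forall>a\<in>I. a \<odot>\<^bsub>E i\<^esub> y = \<zero>\<^bsub>E i\<^esub>) \<and> d i y = z)"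
    using nontrivial[OF res] by (elim bexE conjE) (rule that)
  have z_cocycle: "z \<in> cocycles ?C d (Suc i)" using z by (simp add: cocycles_def car C)
  have z_coboundary: "z \<notin> coboundaries ?C d (Suc i)" using z(4) by (auto simp: coboundaries_def car)
  interpret Ei: module R "E i" by (rule E)
  interpret Es: module R "E (Suc i)" by (rule E)
  \<comment> \<open>Zero in cohomology is the set of coboundaries itself. As this set contains 0,
    the coset of \<open>z\<close> contains \<open>z\<close>, which is not a coboundary, and so the
    coset differs from zero.\<close>
  have "\<zero>\<^bsub>E i\<^esub> \<in> carrier (?C i)" using ideal.Icarr[OF I(1)] by (simp add: car)
  then have "\<zero>\<^bsub>E (Suc i)\<^esub> \<in> coboundaries ?C d (Suc i)"
    using mod_hom_zero[OF E E d, of i] by (force simp: coboundaries_def)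
  then have mem: "z \<in> coboundaries ?C d (Suc i) +>\<^bsub>?C (Suc i)\<lparr>carrier := cocycles ?C d (Suc i)\<rparr>\<^esub> z"
    using z(1) by (auto simp: a_r_coset_def' C intro!: bexI[of _ "\<zero>\<^bsub>E (Suc i)\<^esub>"])
  have "coboundaries ?C d (Suc i) +>\<^bsub>?C (Suc i)\<lparr>carrier := cocycles ?C d (Suc i)\<rparr>\<^esub> z
      \<in> carrier (derived_torsion R I (Suc i) M)"
    using z_cocycle by (auto simp: eq cohomology_def quotient_module_def A_RCOSETS_def')
  then show ?thesis
    using mem z_coboundary by (auto simp: nonzero_module_def eq cohomology_def quotient_module_def)
qed

section \<open>Maximal ideals of a valuation ring\<close>

context valuation_ring
begin

text \<open>Maximality gives \<open>1 = x + y c\<close> with \<open>x\<close> in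
  \<open>\<mm>\<close>, and \<open>x\<close> and \<open>y c\<close> are comparable. If
  \<open>x\<close> divides \<open>y c\<close>, then 1 lies in \<open>\<mm>\<close>, which is absurd;
  if \<open>y c\<close> divides \<open>x\<close>, then \<open>c\<close> divides 1.\<close>

lemma not_in_maximalideal_imp_Unit:
  assumes "maximalideal \<mm> R" "c \<in> carrier R" "c \<notin> \<mm>"
  shows "c \<in> Units R"
proof -
  interpret m: maximalideal \<mm> R by fact
  let ?J = "\<mm> <+>\<^bsub>R\<^esub> PIdl c"
  have J: "ideal ?J R" using assms(2) by (intro add_ideals m.is_ideal cgenideal_ideal)
  interpret C: ideal "PIdl c" R using assms(2) by (rule cgenideal_ideal)
  have mJ: "\<mm> \<subseteq> ?J"
  proof
    fix x assume "x \<in> \<mm>"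
    then have "x = x \<oplus> \<zero>" by (simp add: m.Icarr)
    then show "x \<in> ?J" unfolding set_add_def' using \<open>x \<in> \<mm>\<close> C.zero_closed by blast
  qed
  have "c = \<zero> \<oplus> c" using assms(2) by simp
  then have cJ: "c \<in> ?J"
    unfolding set_add_def' using m.zero_closed cgenideal_self[OF assms(2)] by blast
  then have "?J = carrier R"
    using m.I_maximal[OF J mJ] assms(3) ideal.Icarr[OF J] by blast
  then have "\<one> \<in> ?J" by simp
  then obtain x w where x: "x \<in> \<mm>" and w: "w \<in> PIdl c" and "\<one> = x \<oplus> w"
    unfolding set_add_def' by blast
  moreover from w obtain y where y: "y \<in> carrier R" and "w = y \<otimes> c"
    unfolding cgenideal_def by blast
  ultimately have one: "\<one> = x \<oplus> y \<otimes> c" by simp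
  have xc: "x \<in> carrier R" and yc: "y \<otimes> c \<in> carrier R" using x y assms(2) m.Icarr by auto
  from divides_total[OF xc yc] show ?thesis
  proof
    assume "x divides y \<otimes> c"
    then obtain z where z: "z \<in> carrier R" "y \<otimes> c = x \<otimes> z" by (auto elim: dividesE)
    then have "\<one> \<in> \<mm>" using one x m.I_r_closed[OF x z(1)] m.a_closed by metis
    then have "\<mm> = carrier R" using m.one_imp_carrier by simp
    then show ?thesis using m.I_notcarr by simp
  next
    assume "y \<otimes> c divides x"
    then obtain z where z: "z \<in> carrier R" "x = y \<otimes> c \<otimes> z" by (auto elim: dividesE)
    then have "\<one> = c \<otimes> (y \<otimes> z \<oplus> y)"
      using one y assms(2) by (simp add: r_distr m_ac)
    then show ?thesis using z(1) y assms(2) by (metis Units_one_closed a_closed m_closed unit_factor)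
  qed
qed

text \<open>For \<open>a\<close> in \<open>\<mm>\<close> the principal ideal of \<open>a\<close> is
  not all of \<open>\<mm>\<close>, so some \<open>b\<close> in \<open>\<mm>\<close> lies outside it.
  Then \<open>a\<close> does not divide \<open>b\<close>, whence \<open>a = b c\<close>; were
  \<open>c\<close> a unit, \<open>b\<close> would be a multiple of \<open>a\<close>. So both factors
  lie in \<open>\<mm>\<close>.\<close>

lemma maximalideal_idempotent:
  assumes "maximalideal \<mm> R" "\<not> fin_gen_ideal R \<mm>"
  shows "\<mm> \<cdot> \<mm> = \<mm>"
proof
  interpret m: maximalideal \<mm> R by fact
  show "\<mm> \<cdot> \<mm> \<subseteq> \<mm>" using ideal_prod_inter[OF m.is_ideal m.is_ideal] by blast
  show "\<mm> \<subseteq> \<mm> \<cdot> \<mm>"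
  proof
    fix a assume a: "a \<in> \<mm>"
    then have ac: "a \<in> carrier R" by (rule m.Icarr)
    have "Idl {a} \<subseteq> \<mm>" using a by (intro genideal_minimal m.is_ideal) simp
    moreover have "Idl {a} \<noteq> \<mm>" using assms(2) ac unfolding fin_gen_ideal_def
      by (metis bot.extremum finite.emptyI finite.insertI insert_subset)
    ultimately obtain b where b: "b \<in> \<mm>" "b \<notin> Idl {a}" by blast
    then have bc: "b \<in> carrier R" by (simp add: m.Icarr)
    interpret A: ideal "Idl {a}" R using ac by (intro genideal_ideal) simp
    have aA: "a \<in> Idl {a}" using genideal_self[of "{a}"] ac by simp
    have "\<not> a divides b" using b(2) A.I_r_closed[OF aA] by (auto elim: dividesE)
    then obtain c where c: "c \<in> carrier R" "a = b \<otimes> c"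
      using divides_total[OF ac bc] by (auto elim: dividesE)
    have "c \<in> \<mm>"
    proof (rule ccontr)
      assume "c \<notin> \<mm>"
      then have "c \<in> Units R" using not_in_maximalideal_imp_Unit assms(1) c(1) by blast
      then have "b = a \<otimes> inv c" using c bc by (simp add: m_assoc Units_r_inv)
      then show False using b(2) A.I_r_closed[OF aA] \<open>c \<in> Units R\<close> by simp
    qed
    then show "a \<in> \<mm> \<cdot> \<mm>" using b(1) c(2) ideal_prod.prod by metis
  qed
qed

lemma maximalideal_nonzero:
  assumes "maximalideal \<mm> R" "\<not> fin_gen_ideal R \<mm>"
  obtains a where "a \<in> \<mm>" "a \<noteq> \<zero>"
proof -
  interpret m: maximalideal \<mm> R by fact
  have "\<mm> \<noteq> {\<zero>}"
    using assms(2) genideal_zero unfolding fin_gen_ideal_def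
    by (metis finite.emptyI finite.insertI insert_subset empty_subsetI zero_closed)
  then show ?thesis using that m.zero_closed by blast
qed

text \<open>
  The sequence \<open>0 \<rightarrow> \<mm> \<rightarrow> R \<rightarrow> R/\<mm> \<rightarrow> 0\<close> does not split; its class is the image of \<open>1\<close> under
  \<open>R \<rightarrow> E\<^sup>0 \<rightarrow> E\<^sup>1\<close>.
\<close>

lemma nonzero_derived_torsion_1:
  assumes max: "maximalideal \<mm> R" and nfg: "\<not> fin_gen_ideal R \<mm>"
  shows "nonzero_module (derived_torsion R \<mm> (Suc 0) (ideal_module R \<mm>))"
proof -
  interpret m: maximalideal \<mm> R by fact
  have M: "module R (ideal_module R \<mm>)" by (rule module_ideal[OF m.is_ideal])
  show ?thesis
  proof (rule nonzero_derived_torsionI[OF M m.is_ideal maximalideal_idempotent[OF assms]])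
    fix E :: "nat \<Rightarrow> ('a, ('a, 'a) resolution_type) module" and \<epsilon> d
    assume res: "injective_resolution R (ideal_module R \<mm>) E \<epsilon> d"
    note res' = res[unfolded injective_resolution_def]
    have E: "module R (E n)" for n using res' by (simp add: injective_module_def)
    have d: "d n \<in> mod_hom R (E n) (E (Suc n))" for n using res' by simp
    have \<epsilon>: "\<epsilon> \<in> mod_hom R (ideal_module R \<mm>) (E 0)" "inj_on \<epsilon> (carrier (ideal_module R \<mm>))"
      using res' by auto
    have ex0: "\<epsilon> ` \<mm> = {x \<in> carrier (E 0). d 0 x = \<zero>\<^bsub>E 1\<^esub>}"
      using res' by (simp add: ideal_module_def)
    have ex: "d n ` carrier (E n) = {x \<in> carrier (E (Suc n)). d (Suc n) x = \<zero>\<^bsub>E (Suc (Suc n))\<^esub>}" for n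
      using res' by simp
    interpret E0: module R "E 0" by (rule E)
    interpret E1: module R "E 1" by (rule E)
    have "(\<lambda>x. x) \<in> mod_hom R (ideal_module R \<mm>) (ideal_module R (carrier R))"
      by (rule mod_homI) (auto simp: ideal_module_def m.Icarr)
    then obtain g where g: "g \<in> mod_hom R (ideal_module R (carrier R)) (E 0)"
      "\<And>x. x \<in> carrier (ideal_module R \<mm>) \<Longrightarrow> g x = \<epsilon> x"
      using injective_module_extension[of R "E 0" "ideal_module R \<mm>" "ideal_module R (carrier R)" "\<lambda>x. x" \<epsilon>
        "\<lambda>x. {[Inl x]}"] res' M module_ring \<epsilon>(1) by (auto simp: inj_on_def)
    \<comment> \<open>Since \<open>g\<close> extends \<open>\<epsilon>\<close>, multiplying
      \<open>x\<close> by \<open>a\<close> in \<open>\<mm>\<close> gives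
      \<open>\<epsilon> a\<close>. Hence \<open>d 0 x\<close> is killed by \<open>\<mm>\<close>,
      although \<open>x\<close> is not.\<close>
    define x where "x = g \<one>"
    have x: "x \<in> carrier (E 0)" using mod_homD(1)[OF g(1)] by (simp add: x_def ideal_module_def)
    have ax: "a \<odot>\<^bsub>E 0\<^esub> x = \<epsilon> a" if "a \<in> \<mm>" for a
      using mod_homD(3)[OF g(1), of a \<one>] g(2)[of a] that m.Icarr[OF that]
      by (simp add: x_def ideal_module_def)
    have adx: "a \<odot>\<^bsub>E 1\<^esub> d 0 x = \<zero>\<^bsub>E 1\<^esub>" if "a \<in> \<mm>" for a
    proof -
      have "a \<odot>\<^bsub>E 1\<^esub> d 0 x = d 0 (\<epsilon> a)"
        using mod_homD(3)[OF d[of 0] m.Icarr[OF that] x] ax[OF that] by simp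
      then show ?thesis using ex0 that by auto
    qed
    have "\<not> (\<exists>y\<in>carrier (E 0). (\<forall>a\<in>\<mm>. a \<odot>\<^bsub>E 0\<^esub> y = \<zero>\<^bsub>E 0\<^esub>) \<and> d 0 y = d 0 x)"
    proof
      assume "\<exists>y\<in>carrier (E 0). (\<forall>a\<in>\<mm>. a \<odot>\<^bsub>E 0\<^esub> y = \<zero>\<^bsub>E 0\<^esub>) \<and> d 0 y = d 0 x"
      then obtain y where y: "y \<in> carrier (E 0)" "\<And>a. a \<in> \<mm> \<Longrightarrow> a \<odot>\<^bsub>E 0\<^esub> y = \<zero>\<^bsub>E 0\<^esub>" "d 0 y = d 0 x"
        by blast
      have "d 0 (x \<ominus>\<^bsub>E 0\<^esub> y) = \<zero>\<^bsub>E 1\<^esub>"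
        using mod_hom_diff[OF E E d x y(1)] y(3) mod_homD(1)[OF d x] E1.M.r_neg
        by (simp add: a_minus_def)
      then have "x \<ominus>\<^bsub>E 0\<^esub> y \<in> \<epsilon> ` \<mm>" using x y(1) ex0 by simp
      then obtain b where b: "b \<in> \<mm>" "x \<ominus>\<^bsub>E 0\<^esub> y = \<epsilon> b" by blast
      \<comment> \<open>The element \<open>b\<close> would act as the identity on
        \<open>\<mm>\<close>, making multiplication by \<open>b\<close> a retraction of the ring
        onto \<open>\<mm>\<close>. Cancelling one nonzero \<open>a\<close> forces
        \<open>b = 1\<close>.\<close>
      obtain a where a: "a \<in> \<mm>" "a \<noteq> \<zero>" using maximalideal_nonzero[OF assms] .
      have ac: "a \<in> carrier R" "b \<in> carrier R" using a b m.Icarr by auto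
      have "\<epsilon> (a \<otimes> b) = a \<odot>\<^bsub>E 0\<^esub> (x \<ominus>\<^bsub>E 0\<^esub> y)"
        using mod_homD(3)[OF \<epsilon>(1) ac(1), of b] b by (simp add: ideal_module_def)
      also have "\<dots> = \<epsilon> a"
        using x y a ac ax mod_homD(1)[OF \<epsilon>(1), of a]
        by (simp add: a_minus_def E0.smult_r_distr E0.smult_r_minus ideal_module_def E0.M.add.inv_one)
      finally have "a \<otimes> b = a \<otimes> \<one>"
        using \<epsilon>(2) a(1) b(1) ac m.I_l_closed by (simp add: inj_on_def ideal_module_def)
      then have "b = \<one>" using a(2) ac m_lcancel by blast
      then have "\<mm> = carrier R" using b(1) m.one_imp_carrier by simp
      then show False using m.I_notcarr by simp
    qed
    moreover have "d 0 x \<in> carrier (E (Suc 0))" "d (Suc 0) (d 0 x) = \<zero>\<^bsub>E (Suc (Suc 0))\<^esub>"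
      using ex[of 0] x by auto
    ultimately show "\<exists>z\<in>carrier (E (Suc 0)). d (Suc 0) z = \<zero>\<^bsub>E (Suc (Suc 0))\<^esub> \<and>
        (\<forall>a\<in>\<mm>. a \<odot>\<^bsub>E (Suc 0)\<^esub> z = \<zero>\<^bsub>E (Suc 0)\<^esub>) \<and>
        \<not> (\<exists>y\<in>carrier (E 0). (\<forall>a\<in>\<mm>. a \<odot>\<^bsub>E 0\<^esub> y = \<zero>\<^bsub>E 0\<^esub>) \<and> d 0 y = z)"
      using adx by (intro bexI[of _ "d 0 x"] conjI) auto
  qed
qed

end

section \<open>Torsion cohomology in degree two\<close>

definition free_module :: "('a, 'r) ring_scheme \<Rightarrow> 'x set \<Rightarrow> ('a, 'x \<Rightarrow> 'a) module" where
  "free_module R X = \<lparr>carrier = {f. (\<forall>x. f x \<in> carrier R) \<and> finite {x. f x \<noteq> \<zero>\<^bsub>R\<^esub>} \<and> {x. f x \<noteq> \<zero>\<^bsub>R\<^esub>} \<subseteq> X},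
     monoid.mult = undefined, one = undefined, zero = (\<lambda>_. \<zero>\<^bsub>R\<^esub>),
     add = (\<lambda>f g x. f x \<oplus>\<^bsub>R\<^esub> g x), smult = (\<lambda>r f x. r \<otimes>\<^bsub>R\<^esub> f x)\<rparr>"

text \<open>Ring elements serve as indices of the basis, and the basis vector at \<open>x\<close> is
  sent to \<open>x\<close> itself; the kernel consists of the linear relations among the
  indices.\<close>

definition lincomb :: "('a, 'r) ring_scheme \<Rightarrow> ('a \<Rightarrow> 'a) \<Rightarrow> 'a" where
  "lincomb R f = (\<Oplus>\<^bsub>R\<^esub>x\<in>{x. f x \<noteq> \<zero>\<^bsub>R\<^esub>}. f x \<otimes>\<^bsub>R\<^esub> x)"

context cring
begin

lemma module_free_module: "module R (free_module R X)"
proof -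
  let ?F = "free_module R X"
  have add: "f \<oplus>\<^bsub>?F\<^esub> g \<in> carrier ?F" if "f \<in> carrier ?F" "g \<in> carrier ?F" for f g
  proof -
    have "{x. f x \<oplus> g x \<noteq> \<zero>} \<subseteq> {x. f x \<noteq> \<zero>} \<union> {x. g x \<noteq> \<zero>}" by auto
    then show ?thesis using that by (auto simp: free_module_def intro: finite_subset)
  qed
  have smult: "r \<odot>\<^bsub>?F\<^esub> f \<in> carrier ?F" if "r \<in> carrier R" "f \<in> carrier ?F" for r f
  proof -
    have "{x. r \<otimes> f x \<noteq> \<zero>} \<subseteq> {x. f x \<noteq> \<zero>}" using that by auto
    then show ?thesis using that by (auto simp: free_module_def intro: finite_subset)
  qed
  have ag: "abelian_group ?F"
  proof (rule abelian_groupI)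
    show "\<exists>g\<in>carrier ?F. g \<oplus>\<^bsub>?F\<^esub> f = \<zero>\<^bsub>?F\<^esub>" if "f \<in> carrier ?F" for f
      using smult[of "\<ominus> \<one>" f] that
      by (intro bexI[of _ "\<ominus> \<one> \<odot>\<^bsub>?F\<^esub> f"]) (auto simp: free_module_def l_minus l_neg)
  qed (fact add, auto simp: free_module_def a_ac)
  show ?thesis
    by (rule moduleI[OF is_cring ag smult]) (auto simp: free_module_def l_distr r_distr m_assoc)
qed

text \<open>Supports change under addition and scaling, so comparing linear combinations requires
  summing over a common finite set.\<close>

lemma lincomb_eq:
  assumes "f \<in> carrier (free_module R X)" "finite S" "{x. f x \<noteq> \<zero>} \<subseteq> S" "S \<subseteq> carrier R"
  shows "lincomb R f = (\<Oplus>x\<in>S. f x \<otimes> x)"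
  unfolding lincomb_def using assms
  by (intro add.finprod_mono_neutral_cong_left) (auto simp: free_module_def)

lemma lincomb_hom:
  assumes "X \<subseteq> carrier R"
  shows "lincomb R \<in> mod_hom R (free_module R X) (ideal_module R (carrier R))"
proof -
  interpret F: module R "free_module R X" by (rule module_free_module)
  have fD: "f x \<in> carrier R" "finite {x. f x \<noteq> \<zero>}" "{x. f x \<noteq> \<zero>} \<subseteq> carrier R"
    if "f \<in> carrier (free_module R X)" for f x
    using that assms by (auto simp: free_module_def)
  show ?thesis
  proof (rule mod_homI)
    fix f assume f: "f \<in> carrier (free_module R X)"
    note f' = fD[OF f]
    show "lincomb R f \<in> carrier (ideal_module R (carrier R))"
      using f' by (auto simp: lincomb_def ideal_module_def intro!: finsum_closed)
    fix g assume g: "g \<in> carrier (free_module R X)"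
    note g' = fD[OF g]
    let ?S = "{x. f x \<noteq> \<zero>} \<union> {x. g x \<noteq> \<zero>}"
    have S: "finite ?S" "?S \<subseteq> carrier R" using f' g' by auto
    have "lincomb R (f \<oplus>\<^bsub>free_module R X\<^esub> g) = (\<Oplus>x\<in>?S. (f \<oplus>\<^bsub>free_module R X\<^esub> g) x \<otimes> x)"
      using f g S by (intro lincomb_eq[of _ X] F.M.a_closed) (auto simp: free_module_def)
    also have "\<dots> = (\<Oplus>x\<in>?S. f x \<otimes> x \<oplus> g x \<otimes> x)"
      using f'(1) g'(1) S by (intro finsum_cong') (auto simp: free_module_def l_distr)
    also have "\<dots> = (\<Oplus>x\<in>?S. f x \<otimes> x) \<oplus> (\<Oplus>x\<in>?S. g x \<otimes> x)"
      using f'(1) g'(1) S by (intro finsum_addf) auto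
    also have "\<dots> = lincomb R f \<oplus> lincomb R g"
      using lincomb_eq[OF f S(1) _ S(2)] lincomb_eq[OF g S(1) _ S(2)] by simp
    finally show "lincomb R (f \<oplus>\<^bsub>free_module R X\<^esub> g) = lincomb R f \<oplus>\<^bsub>ideal_module R (carrier R)\<^esub> lincomb R g"
      by (simp add: ideal_module_def)
  next
    fix r f assume r: "r \<in> carrier R" and f: "f \<in> carrier (free_module R X)"
    note f' = fD[OF f]
    let ?S = "{x. f x \<noteq> \<zero>}"
    have "lincomb R (r \<odot>\<^bsub>free_module R X\<^esub> f) = (\<Oplus>x\<in>?S. (r \<odot>\<^bsub>free_module R X\<^esub> f) x \<otimes> x)"
      using f' r f by (intro lincomb_eq[of _ X] F.smult_closed) (auto simp: free_module_def)
    also have "\<dots> = (\<Oplus>x\<in>?S. r \<otimes> (f x \<otimes> x))"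
      using f' r by (intro finsum_cong') (auto simp: free_module_def m_assoc)
    also have "\<dots> = r \<otimes> lincomb R f"
      unfolding lincomb_def using f' r by (intro finsum_rdistr[symmetric]) auto
    finally show "lincomb R (r \<odot>\<^bsub>free_module R X\<^esub> f) = r \<odot>\<^bsub>ideal_module R (carrier R)\<^esub> lincomb R f"
      by (simp add: ideal_module_def)
  qed
qed

lemma lincomb_in_ideal:
  assumes "ideal I R" "X \<subseteq> I" "f \<in> carrier (free_module R X)"
  shows "lincomb R f \<in> I"
proof -
  interpret I: ideal I R by fact
  have *: "(\<Oplus>x\<in>S. f x \<otimes> x) \<in> I" if "finite S" "S \<subseteq> I" for S
    using that
  proof (induct S rule: finite_induct)
    case empty
    then show ?case by (simp add: I.zero_closed)
  next
    case (insert x S)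
    have "f y \<in> carrier R" for y using assms(3) by (simp add: free_module_def)
    moreover have "S \<subseteq> carrier R" "x \<in> carrier R" "x \<in> I" using insert.prems I.Icarr by auto
    ultimately have "(\<Oplus>y\<in>insert x S. f y \<otimes> y) = f x \<otimes> x \<oplus> (\<Oplus>y\<in>S. f y \<otimes> y)"
      using insert.hyps by (intro finsum_insert) auto
    then show ?case using insert \<open>f x \<in> carrier R\<close> \<open>x \<in> I\<close> by (simp add: I.I_l_closed I.a_closed)
  qed
  show ?thesis unfolding lincomb_def
    using assms(2,3) by (intro *) (auto simp: free_module_def)
qed

end

text \<open>
  A function with these properties is a section of the surjection from the free module on \<open>I\<close> onto
  \<open>I\<close>. All its nonzero values have the same, finite, support, and \<open>I\<close> is generated by that support.
\<close>

lemma (in domain) fin_gen_ideal_of_section: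
  assumes I: "ideal I R" and s: "\<And>a. a \<in> I \<Longrightarrow> s a \<in> carrier (free_module R I)"
    and lin: "\<And>a. a \<in> I \<Longrightarrow> lincomb R (s a) = a"
    and compat: "\<And>a b c. a \<in> I \<Longrightarrow> b \<in> I \<Longrightarrow> b \<otimes> s a c = a \<otimes> s b c"
  shows "fin_gen_ideal R I"
proof (cases "I = {\<zero>}")
  case True
  then have "I = Idl {}"
    using genideal_minimal[OF I, of "{}"] genideal_ideal[of "{}"] additive_subgroup.zero_closed ideal_def by blast
  then show ?thesis unfolding fin_gen_ideal_def by (intro exI[of _ "{}"]) simp
next
  case False
  interpret I: ideal I R by fact
  obtain a where a: "a \<in> I" "a \<noteq> \<zero>" using False I.zero_closed by blast
  let ?S = "{c. s a c \<noteq> \<zero>}"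
  have S: "finite ?S" "?S \<subseteq> I" using s[OF a(1)] by (auto simp: free_module_def)
  then have SR: "?S \<subseteq> carrier R" using I.Icarr by auto
  have "I \<subseteq> Idl ?S"
  proof
    fix b assume b: "b \<in> I"
    \<comment> \<open>By \<open>compat\<close>, \<open>a\<close> times this coefficient is
      \<open>b\<close> times a zero coefficient of \<open>s a\<close>, and the nonzero
      \<open>a\<close> cancels in a domain.\<close>
    have "s b c = \<zero>" if "c \<notin> ?S" for c
    proof -
      have "a \<otimes> s b c = \<zero>" using compat[OF a(1) b, of c] that b I.Icarr by simp
      moreover have "s b c \<in> carrier R" using s[OF b] by (simp add: free_module_def)
      ultimately show ?thesis using integral a I.Icarr by blast
    qed
    then have "s b \<in> carrier (free_module R ?S)" using s[OF b] by (auto simp: free_module_def)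
    then have "lincomb R (s b) \<in> Idl ?S"
      using genideal_ideal[OF SR] genideal_self[OF SR] by (intro lincomb_in_ideal)
    then show "b \<in> Idl ?S" using lin[OF b] by simp
  qed
  moreover have "Idl ?S \<subseteq> I" using S(2) by (intro genideal_minimal I)
  ultimately show ?thesis using S(1) SR unfolding fin_gen_ideal_def by blast
qed

context valuation_ring
begin

text \<open>
  Let \<open>0 \<rightarrow> K \<rightarrow> F \<rightarrow> \<mm> \<rightarrow> 0\<close> be a free presentation. If the class in \<open>R\<^sup>2\<Gamma>(K)\<close> built from it
  vanished, then so would the class of this extension, and \<open>\<mm>\<close> would be projective.
\<close>

lemma nonzero_derived_torsion_2:
  assumes max: "maximalideal \<mm> R" and nfg: "\<not> fin_gen_ideal R \<mm>"
  defines "K \<equiv> {f \<in> carrier (free_module R \<mm>). lincomb R f = \<zero>}"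
  defines "M \<equiv> free_module R \<mm> \<lparr>carrier := K\<rparr>"
  shows "module R M" and "nonzero_module (derived_torsion R \<mm> (Suc (Suc 0)) M)"
proof -
  interpret m: maximalideal \<mm> R by fact
  have sub: "\<mm> \<subseteq> carrier R" using m.Icarr by blast
  let ?F = "free_module R \<mm>"
  interpret F: module R ?F by (rule module_free_module)
  have lc: "lincomb R \<in> mod_hom R ?F (ideal_module R (carrier R))" using sub by (rule lincomb_hom)
  have lc_add: "lincomb R (f \<oplus>\<^bsub>?F\<^esub> g) = lincomb R f \<oplus> lincomb R g"
    if "f \<in> carrier ?F" "g \<in> carrier ?F" for f g
    using mod_homD(2)[OF lc that] by (simp add: ideal_module_def)
  have lc_smult: "lincomb R (r \<odot>\<^bsub>?F\<^esub> f) = r \<otimes> lincomb R f"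
    if "r \<in> carrier R" "f \<in> carrier ?F" for f r
    using mod_homD(3)[OF lc that] by (simp add: ideal_module_def)
  have lc_m: "lincomb R f \<in> \<mm>" if "f \<in> carrier ?F" for f
    using m.is_ideal _ that by (rule lincomb_in_ideal) simp
  have lc_car: "lincomb R f \<in> carrier R" if "f \<in> carrier ?F" for f
    using lc_m[OF that] by (rule m.Icarr)
  have lc_minus: "lincomb R (f \<ominus>\<^bsub>?F\<^esub> g) = lincomb R f \<ominus> lincomb R g"
    if "f \<in> carrier ?F" "g \<in> carrier ?F" for f g
  proof -
    have "\<ominus>\<^bsub>?F\<^esub> g = (\<ominus> \<one>) \<odot>\<^bsub>?F\<^esub> g" using that by (simp add: F.smult_l_minus)
    then show ?thesis using that lc_car
      by (simp add: a_minus_def lc_add lc_smult l_minus)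
  qed
  have F_minus: "(f \<ominus>\<^bsub>?F\<^esub> g) c = f c \<ominus> g c" if "f \<in> carrier ?F" "g \<in> carrier ?F" for f g c
  proof -
    have "\<ominus>\<^bsub>?F\<^esub> g = (\<ominus> \<one>) \<odot>\<^bsub>?F\<^esub> g" using that by (simp add: F.smult_l_minus)
    then show ?thesis using that by (simp add: a_minus_def) (simp add: free_module_def l_minus)
  qed
  \<comment> \<open>The basis vectors give a set-theoretic section of \<open>lincomb R\<close>, not
    a linear one.\<close>
  define e where "e a = (\<lambda>c. if c = a then \<one> else \<zero>)" for a :: 'a
  have e: "e a \<in> carrier ?F" if "a \<in> \<mm>" for a using that by (auto simp: e_def free_module_def)
  have lc_e: "lincomb R (e a) = a" if "a \<in> \<mm>" for a
  proof -
    have "lincomb R (e a) = (\<Oplus>c\<in>{a}. e a c \<otimes> c)"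
      using that sub by (intro lincomb_eq[OF e[OF that]]) (auto simp: e_def)
    then show ?thesis using m.Icarr[OF that] by (simp add: e_def)
  qed
  have K: "submodule K R ?F"
    using submodule_kernel[OF F.module_axioms module_ring lc] by (simp add: K_def ideal_module_def)
  have KF: "f \<in> carrier ?F" if "f \<in> K" for f using that by (simp add: K_def)
  show M: "module R M" unfolding M_def by (rule submodule.submodule_is_module[OF K F.module_axioms])
  have M_simps: "carrier M = K" "add M = add ?F" "smult M = smult ?F" "zero M = zero ?F"
    by (simp_all add: M_def)
  show "nonzero_module (derived_torsion R \<mm> (Suc (Suc 0)) M)"
  proof (rule nonzero_derived_torsionI[OF M m.is_ideal maximalideal_idempotent[OF max nfg]])
    fix E :: "nat \<Rightarrow> ('a, ('a, 'a \<Rightarrow> 'a) resolution_type) module" and \<epsilon> d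
    assume res: "injective_resolution R M E \<epsilon> d"
    note res' = res[unfolded injective_resolution_def]
    have inj: "injective_module R (E n)" for n using res' by simp
    then have E: "module R (E n)" for n by (simp add: injective_module_def)
    have d: "d n \<in> mod_hom R (E n) (E (Suc n))" for n using res' by simp
    have \<epsilon>: "\<epsilon> \<in> mod_hom R M (E 0)" "inj_on \<epsilon> K" using res' by (auto simp: M_simps)
    have ex0: "\<epsilon> ` K = {x \<in> carrier (E 0). d 0 x = \<zero>\<^bsub>E 1\<^esub>}" using res' by (simp add: M_simps)
    have ex: "d n ` carrier (E n) = {x \<in> carrier (E (Suc n)). d (Suc n) x = \<zero>\<^bsub>E (Suc (Suc n))\<^esub>}" for n
      using res' by simp
    have dd: "d (Suc n) (d n x) = \<zero>\<^bsub>E (Suc (Suc n))\<^esub>" if "x \<in> carrier (E n)" for n x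
      using ex[of n] that by auto
    note dD = mod_homD[OF d]
    interpret E0: module R "E 0" by (rule E)
    interpret E1: module R "E (Suc 0)" by (rule E)
    interpret E2: module R "E (Suc (Suc 0))" by (rule E)
    have "(\<lambda>f. f) \<in> mod_hom R M ?F" by (rule mod_homI) (auto simp: M_simps KF)
    then obtain \<phi> where \<phi>: "\<phi> \<in> mod_hom R ?F (E 0)" "\<And>f. f \<in> carrier M \<Longrightarrow> \<phi> f = \<epsilon> f"
      by (rule injective_module_extension[OF inj M F.module_axioms _ _ \<epsilon>(1), where h = "\<lambda>f. {[Inr f]}"])
        (auto simp: inj_on_def)
    note \<phi>D = mod_homD[OF \<phi>(1)]
    have d\<phi>: "(\<lambda>f. d 0 (\<phi> f)) \<in> mod_hom R ?F (E (Suc 0))" using \<phi>(1) d by (rule mod_hom_comp)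
    \<comment> \<open>On \<open>K\<close> the map \<open>\<phi>\<close> is
      \<open>\<epsilon>\<close>, which \<open>d 0\<close> kills. So \<open>d 0\<close> after
      \<open>\<phi>\<close> factors through \<open>lincomb R\<close> and induces
      \<open>\<psi>\<close> on \<open>\<mm>\<close>; \<open>e a\<close> merely serves as a preimage
      of \<open>a\<close>. This \<open>\<psi>\<close> represents the class of the free
      presentation.\<close>
    have d\<phi>_eq: "d 0 (\<phi> f) = d 0 (\<phi> g)"
      if fg: "f \<in> carrier ?F" "g \<in> carrier ?F" "lincomb R f = lincomb R g" for f g
    proof -
      have "f \<ominus>\<^bsub>?F\<^esub> g \<in> K" using fg lc_car by (simp add: K_def lc_minus)
      then have "d 0 (\<phi> (f \<ominus>\<^bsub>?F\<^esub> g)) = \<zero>\<^bsub>E (Suc 0)\<^esub>" using \<phi>(2) ex0 by (auto simp: M_simps)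
      then have "d 0 (\<phi> f) \<ominus>\<^bsub>E (Suc 0)\<^esub> d 0 (\<phi> g) = \<zero>\<^bsub>E (Suc 0)\<^esub>"
        using mod_hom_diff[OF F.module_axioms E d\<phi> fg(1,2)] by simp
      then show ?thesis using fg dD(1) \<phi>D(1) by simp
    qed
    define \<psi> where "\<psi> a = d 0 (\<phi> (e a))" for a
    have \<psi>: "\<psi> \<in> mod_hom R (ideal_module R \<mm>) (E (Suc 0))"
    proof (rule mod_homI)
      fix a assume "a \<in> carrier (ideal_module R \<mm>)"
      then have a: "a \<in> \<mm>" by (simp add: ideal_module_def)
      show "\<psi> a \<in> carrier (E (Suc 0))" using mod_homD(1)[OF d\<phi> e[OF a]] by (simp add: \<psi>_def)
      fix b assume "b \<in> carrier (ideal_module R \<mm>)"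
      then have b: "b \<in> \<mm>" by (simp add: ideal_module_def)
      have "\<psi> (a \<oplus> b) = d 0 (\<phi> (e a \<oplus>\<^bsub>?F\<^esub> e b))"
        unfolding \<psi>_def using a b by (intro d\<phi>_eq) (simp_all add: e lc_e lc_add m.a_closed)
      also have "\<dots> = \<psi> a \<oplus>\<^bsub>E (Suc 0)\<^esub> \<psi> b"
        using mod_homD(2)[OF d\<phi> e[OF a] e[OF b]] by (simp add: \<psi>_def)
      finally show "\<psi> (a \<oplus>\<^bsub>ideal_module R \<mm>\<^esub> b) = \<psi> a \<oplus>\<^bsub>E (Suc 0)\<^esub> \<psi> b" by (simp add: ideal_module_def)
    next
      fix r a assume r: "r \<in> carrier R" and "a \<in> carrier (ideal_module R \<mm>)"
      then have a: "a \<in> \<mm>" by (simp add: ideal_module_def)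
      have "\<psi> (r \<otimes> a) = d 0 (\<phi> (r \<odot>\<^bsub>?F\<^esub> e a))"
        unfolding \<psi>_def using a r by (intro d\<phi>_eq) (simp_all add: e lc_e lc_smult m.I_l_closed)
      also have "\<dots> = r \<odot>\<^bsub>E (Suc 0)\<^esub> \<psi> a"
        using mod_homD(3)[OF d\<phi> r e[OF a]] by (simp add: \<psi>_def)
      finally show "\<psi> (r \<odot>\<^bsub>ideal_module R \<mm>\<^esub> a) = r \<odot>\<^bsub>E (Suc 0)\<^esub> \<psi> a" by (simp add: ideal_module_def)
    qed
    have "(\<lambda>x. x) \<in> mod_hom R (ideal_module R \<mm>) (ideal_module R (carrier R))"
      by (rule mod_homI) (auto simp: ideal_module_def m.Icarr)
    then obtain g where g: "g \<in> mod_hom R (ideal_module R (carrier R)) (E (Suc 0))"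
      "\<And>x. x \<in> carrier (ideal_module R \<mm>) \<Longrightarrow> g x = \<psi> x"
      by (rule injective_module_extension[OF inj module_ideal[OF m.is_ideal] module_ring _ _ \<psi>,
            where h = "\<lambda>x. {[Inl x]}"]) (auto simp: inj_on_def)
    \<comment> \<open>The second shift of degree: \<open>\<psi>\<close> extends to the ring, and
      \<open>d (Suc 0) y\<close> is killed by \<open>\<mm>\<close> because multiples of
      \<open>y\<close> by \<open>\<mm>\<close> are values of \<open>\<psi>\<close>, which lie in the
      image of \<open>d 0\<close>.\<close>
    define y where "y = g \<one>"
    have y: "y \<in> carrier (E (Suc 0))" using mod_homD(1)[OF g(1)] by (simp add: y_def ideal_module_def)
    have ay: "a \<odot>\<^bsub>E (Suc 0)\<^esub> y = \<psi> a" if "a \<in> \<mm>" for a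
      using mod_homD(3)[OF g(1), of a \<one>] g(2)[of a] that m.Icarr[OF that]
      by (simp add: y_def ideal_module_def)
    have ady: "a \<odot>\<^bsub>E (Suc (Suc 0))\<^esub> d (Suc 0) y = \<zero>\<^bsub>E (Suc (Suc 0))\<^esub>" if "a \<in> \<mm>" for a
    proof -
      have "a \<odot>\<^bsub>E (Suc (Suc 0))\<^esub> d (Suc 0) y = d (Suc 0) (\<psi> a)"
        using dD(3)[OF m.Icarr[OF that] y] ay[OF that] by simp
      then show ?thesis using dd[OF \<phi>D(1)[OF e[OF that]]] by (simp add: \<psi>_def)
    qed
    have nontrivial: "\<not> (\<exists>y'\<in>carrier (E (Suc 0)). (\<forall>a\<in>\<mm>. a \<odot>\<^bsub>E (Suc 0)\<^esub> y' = \<zero>\<^bsub>E (Suc 0)\<^esub>) \<and> d (Suc 0) y' = d (Suc 0) y)"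
    proof
      assume "\<exists>y'\<in>carrier (E (Suc 0)). (\<forall>a\<in>\<mm>. a \<odot>\<^bsub>E (Suc 0)\<^esub> y' = \<zero>\<^bsub>E (Suc 0)\<^esub>) \<and> d (Suc 0) y' = d (Suc 0) y"
      then obtain y' where y': "y' \<in> carrier (E (Suc 0))"
          "\<And>a. a \<in> \<mm> \<Longrightarrow> a \<odot>\<^bsub>E (Suc 0)\<^esub> y' = \<zero>\<^bsub>E (Suc 0)\<^esub>" "d (Suc 0) y' = d (Suc 0) y"
        by blast
      have "d (Suc 0) (y \<ominus>\<^bsub>E (Suc 0)\<^esub> y') = \<zero>\<^bsub>E (Suc (Suc 0))\<^esub>"
        using mod_hom_diff[OF E E d y y'(1)] y'(3) dD(1)[OF y] E2.M.r_neg by (simp add: a_minus_def)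
      then have "y \<ominus>\<^bsub>E (Suc 0)\<^esub> y' \<in> d 0 ` carrier (E 0)" using y y'(1) ex[of 0] by simp
      then obtain w where w: "w \<in> carrier (E 0)" "d 0 w = y \<ominus>\<^bsub>E (Suc 0)\<^esub> y'" by auto
      \<comment> \<open>\<open>d 0 w\<close> and \<open>y\<close> differ by an element killed by
        \<open>\<mm>\<close>, so sending \<open>a\<close> to \<open>a w\<close> lifts
        \<open>\<psi>\<close> through \<open>d 0\<close>.\<close>
      have adw: "a \<odot>\<^bsub>E (Suc 0)\<^esub> d 0 w = \<psi> a" if "a \<in> \<mm>" for a
        using that y y' ay mod_homD(1)[OF \<psi>, of a] m.Icarr[OF that]
        by (simp add: w a_minus_def E1.smult_r_distr E1.smult_r_minus ideal_module_def E1.M.add.inv_one)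
      \<comment> \<open>Subtracting this lift makes \<open>\<phi>\<close> take values in the kernel
        of \<open>d 0\<close>, the image of \<open>K\<close>, without changing it on
        \<open>K\<close>. Up to the identification by \<open>\<epsilon>\<close>,
        \<open>\<theta>\<close> is a retraction of the free module onto \<open>K\<close>.\<close>
      define \<theta> where "\<theta> f = \<phi> f \<ominus>\<^bsub>E 0\<^esub> lincomb R f \<odot>\<^bsub>E 0\<^esub> w" for f
      have \<theta>_closed: "\<theta> f \<in> carrier (E 0)" if "f \<in> carrier ?F" for f
        using that \<phi>D(1) lc_car w(1) by (simp add: \<theta>_def)
      have \<theta>_K: "\<theta> f \<in> \<epsilon> ` K" if f: "f \<in> carrier ?F" for f
      proof -
        have "d 0 (\<theta> f) = d 0 (\<phi> f) \<ominus>\<^bsub>E (Suc 0)\<^esub> lincomb R f \<odot>\<^bsub>E (Suc 0)\<^esub> d 0 w"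
          unfolding \<theta>_def using f w(1) lc_car \<phi>D(1)
          by (subst mod_hom_diff[OF E E d]) (simp_all add: dD)
        also have "lincomb R f \<odot>\<^bsub>E (Suc 0)\<^esub> d 0 w = d 0 (\<phi> f)"
          unfolding adw[OF lc_m[OF f]] \<psi>_def using f by (intro d\<phi>_eq) (simp_all add: e lc_m lc_e)
        also have "d 0 (\<phi> f) \<ominus>\<^bsub>E (Suc 0)\<^esub> d 0 (\<phi> f) = \<zero>\<^bsub>E (Suc 0)\<^esub>"
          using mod_homD(1)[OF d\<phi> f] by (simp add: a_minus_def E1.M.r_neg)
        finally show ?thesis using \<theta>_closed[OF f] ex0 by simp
      qed
      have \<theta>: "\<theta> \<in> mod_hom R ?F (E 0)"
      proof (rule mod_homI[OF \<theta>_closed])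
        fix f g assume "f \<in> carrier ?F" "g \<in> carrier ?F"
        then show "\<theta> (f \<oplus>\<^bsub>?F\<^esub> g) = \<theta> f \<oplus>\<^bsub>E 0\<^esub> \<theta> g"
          using \<phi>D lc_car w(1)
          by (simp add: \<theta>_def lc_add a_minus_def E0.smult_l_distr E0.M.minus_add E0.M.a_ac)
      next
        fix r f assume "r \<in> carrier R" "f \<in> carrier ?F"
        then show "\<theta> (r \<odot>\<^bsub>?F\<^esub> f) = r \<odot>\<^bsub>E 0\<^esub> \<theta> f"
          using \<phi>D lc_car w(1)
          by (simp add: \<theta>_def lc_smult a_minus_def E0.smult_r_distr E0.smult_r_minus E0.smult_assoc1)
      qed
      have \<theta>_\<epsilon>: "\<theta> f = \<epsilon> f" if "f \<in> K" for f
      proof -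
        have "f \<in> carrier ?F" "lincomb R f = \<zero>" using that by (auto simp: K_def)
        then show ?thesis using \<phi>(2)[of f] that \<phi>D(1)[of f] w(1)
          by (simp add: \<theta>_def M_simps a_minus_def E0.M.add.inv_one)
      qed
      \<comment> \<open>\<open>k a\<close> is the retraction applied to \<open>e a\<close>. Removing
        it leaves the component complementary to \<open>K\<close>, which \<open>lincomb R\<close>
        still sends to \<open>a\<close>.\<close>
      define k where "k a = (SOME f. f \<in> K \<and> \<epsilon> f = \<theta> (e a))" for a
      have k: "k a \<in> K" "\<epsilon> (k a) = \<theta> (e a)" if "a \<in> \<mm>" for a
      proof -
        have "\<exists>f. f \<in> K \<and> \<epsilon> f = \<theta> (e a)" using \<theta>_K[OF e[OF that]] by force
        then have "k a \<in> K \<and> \<epsilon> (k a) = \<theta> (e a)" unfolding k_def by (rule someI_ex)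
        then show "k a \<in> K" "\<epsilon> (k a) = \<theta> (e a)" by auto
      qed
      define s where "s a = e a \<ominus>\<^bsub>?F\<^esub> k a" for a
      have "fin_gen_ideal R \<mm>"
      proof (rule fin_gen_ideal_of_section[OF m.is_ideal, of s])
        show "s a \<in> carrier ?F" if "a \<in> \<mm>" for a using e k(1) KF that by (simp add: s_def)
        show "lincomb R (s a) = a" if "a \<in> \<mm>" for a
          using e[OF that] k(1)[OF that] lc_e[OF that] m.Icarr[OF that]
          by (simp add: s_def lc_minus K_def a_minus_def[of R])
        fix a b c assume a: "a \<in> \<mm>" and b: "b \<in> \<mm>"
        have ab: "a \<in> carrier R" "b \<in> carrier R" using a b m.Icarr by auto
        \<comment> \<open>\<open>?u\<close> is a relation, hence in \<open>K\<close> and fixed by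
          the retraction, while \<open>?v\<close> is its image under the retraction. Their equality
          is the cross relation for \<open>s\<close>, coordinate by coordinate.\<close>
        let ?u = "b \<odot>\<^bsub>?F\<^esub> e a \<ominus>\<^bsub>?F\<^esub> a \<odot>\<^bsub>?F\<^esub> e b"
        let ?v = "b \<odot>\<^bsub>?F\<^esub> k a \<ominus>\<^bsub>?F\<^esub> a \<odot>\<^bsub>?F\<^esub> k b"
        have u: "?u \<in> K"
          using a b ab by (simp add: K_def e lc_minus lc_smult lc_e m_comm)
        have v: "?v \<in> K"
          using a b ab k(1) by (auto simp: K_def lc_minus lc_smult)
        have "\<epsilon> ?v = \<theta> ?v" using \<theta>_\<epsilon>[OF v] by simp
        also have "\<dots> = b \<odot>\<^bsub>E 0\<^esub> \<epsilon> (k a) \<ominus>\<^bsub>E 0\<^esub> a \<odot>\<^bsub>E 0\<^esub> \<epsilon> (k b)"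
          using a b ab k(1) KF
          by (subst mod_hom_diff[OF F.module_axioms E \<theta>]) (simp_all add: mod_homD(3)[OF \<theta>] \<theta>_\<epsilon>)
        also have "\<dots> = \<theta> ?u"
          using a b ab k(2) e
          by (subst mod_hom_diff[OF F.module_axioms E \<theta>]) (simp_all add: mod_homD(3)[OF \<theta>])
        also have "\<dots> = \<epsilon> ?u" using \<theta>_\<epsilon>[OF u] .
        finally have "?v = ?u" using \<epsilon>(2) u v by (auto dest: inj_onD)
        then have "?v c = ?u c" by simp
        have eq: "b \<otimes> k a c \<ominus> a \<otimes> k b c = b \<otimes> e a c \<ominus> a \<otimes> e b c"
        proof -
          have "?v c = b \<otimes> k a c \<ominus> a \<otimes> k b c"
            using a b ab k(1) KF by (subst F_minus) (simp_all, simp add: free_module_def)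
          moreover have "?u c = b \<otimes> e a c \<ominus> a \<otimes> e b c"
            using a b ab e by (subst F_minus) (simp_all, simp add: free_module_def)
          ultimately show ?thesis using \<open>?v c = ?u c\<close> by simp
        qed
        have car: "k a c \<in> carrier R" "k b c \<in> carrier R" "e a c \<in> carrier R" "e b c \<in> carrier R"
          using KF[OF k(1)[OF a]] KF[OF k(1)[OF b]] e[OF a] e[OF b] by (simp_all add: free_module_def)
        have "s a c = e a c \<ominus> k a c" "s b c = e b c \<ominus> k b c"
          using F_minus e k(1) KF a b by (simp_all add: s_def)
        moreover have "b \<otimes> (e a c \<ominus> k a c) = a \<otimes> (e b c \<ominus> k b c)"
        proof -
          have "b \<otimes> (e a c \<ominus> k a c) \<ominus> a \<otimes> (e b c \<ominus> k b c) =
              (b \<otimes> e a c \<ominus> a \<otimes> e b c) \<ominus> (b \<otimes> k a c \<ominus> a \<otimes> k b c)"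
            using car ab by algebra
          also have "\<dots> = \<zero>" unfolding eq using car ab by algebra
          finally show ?thesis using car ab by (simp add: minus_eq_zero_iff)
        qed
        ultimately show "b \<otimes> s a c = a \<otimes> s b c" by simp
      qed
      then show False using nfg by simp
    qed
    show "\<exists>z\<in>carrier (E (Suc (Suc 0))). d (Suc (Suc 0)) z = \<zero>\<^bsub>E (Suc (Suc (Suc 0)))\<^esub> \<and>
        (\<forall>a\<in>\<mm>. a \<odot>\<^bsub>E (Suc (Suc 0))\<^esub> z = \<zero>\<^bsub>E (Suc (Suc 0))\<^esub>) \<and>
        \<not> (\<exists>y\<in>carrier (E (Suc 0)). (\<forall>a\<in>\<mm>. a \<odot>\<^bsub>E (Suc 0)\<^esub> y = \<zero>\<^bsub>E (Suc 0)\<^esub>) \<and> d (Suc 0) y = z)"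
      using ady nontrivial dd[OF y] dD(1)[OF y] by (intro bexI[of _ "d (Suc 0) y"] conjI ballI)
  qed
qed

end

text \<open>The witness in degree two is the module of relations among the elements of
  \<open>\<mm>\<close>, a set of coefficient functions, which accounts for the carrier type
  \<open>'a \<Rightarrow> 'a\<close>.\<close>

theorem proposition3p3:
  fixes V :: "('a, 'r) ring_scheme" and \<mm> :: "'a set"
  assumes "valuation_ring V"
    and "maximalideal \<mm> V"
    and "\<not> fin_gen_ideal V \<mm>"
  shows "nonzero_module (derived_torsion V \<mm> 1 (ideal_module V \<mm>)) \<and>
    (\<exists>M :: ('a, 'a \<Rightarrow> 'a) module. module V M \<and> nonzero_module (derived_torsion V \<mm> 2 M))"
  using valuation_ring.nonzero_derived_torsion_1[OF assms] valuation_ring.nonzero_derived_torsion_2[OF assms]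
  unfolding One_nat_def numeral_2_eq_2 by (intro conjI exI)

end
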